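(* For every $\Gamma\in[8,2d]$ and every diameter bound $\ell>0$, there exists a $(\Gamma,\Lambda)$-hash $\varphi:\mathbb{R}^d\to\mathbb{R}^d$ with diameter bound $\ell$, for $\Lambda=e^{8d/\Gamma}\cdot O(d\log d)$. Furthermore, $\varphi$ can be described by $O(d^2\log^2 d)$ bits and one can evaluate $\varphi(x)$ for an input $x\in\mathbb{R}^d$ in space $O(d^2\log^2 d)$.
   Context: A mapping $\varphi:\mathbb{R}^d\to\mathbb{R}^d$ is a $(\Gamma,\Lambda)$-hash with diameter bound $\ell>0$ if (1) for every $z\in\varphi(\mathbb{R}^d)$, the Euclidean diameter of $\varphi^{-1}(z)$ is at most $\ell$, and (2) every $S\subseteq\mathbb{R}^d$ of Euclidean diameter at most $\ell/\Gamma$ satisfies $|\varphi(S)|\le\Lambda$. *)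

theory Defs
  imports "HOL-Analysis.Analysis" "HOL-Library.Log_Nat"
begin

section \<open>Geometric hashing\<close>

(* The dimension d is quantified inside the statement, so R^d is the carrier of the library's
   Euclidean_space d: functions nat => real that vanish outside {..<d}. *)
abbreviation RR :: "nat \<Rightarrow> (nat \<Rightarrow> real) set" where
  "RR d \<equiv> topspace (Euclidean_space d)"

definition edist :: "nat \<Rightarrow> (nat \<Rightarrow> real) \<Rightarrow> (nat \<Rightarrow> real) \<Rightarrow> real" where
  "edist d x y = L2_set (\<lambda>i. x i - y i) {..<d}"

(* Extended-valued: unbounded sets have diameter \<infinity>, the empty set has diameter 0. *)
definition ediam :: "nat \<Rightarrow> (nat \<Rightarrow> real) set \<Rightarrow> ennreal" where
  "ediam d S = (SUP (x, y) \<in> S \<times> S. ennreal (edist d x y))"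

(* Finiteness of the image is required separately because card of an infinite set is 0. *)
definition is_hash ::
  "nat \<Rightarrow> real \<Rightarrow> real \<Rightarrow> real \<Rightarrow> ((nat \<Rightarrow> real) \<Rightarrow> nat \<Rightarrow> real) \<Rightarrow> bool" where
  "is_hash d \<Gamma> \<Lambda> l \<phi> \<longleftrightarrow>
     0 < l \<and>
     \<phi> \<in> RR d \<rightarrow> RR d \<and>
     (\<forall>z \<in> \<phi> ` RR d. ediam d {x \<in> RR d. \<phi> x = z} \<le> ennreal l) \<and>
     (\<forall>S. S \<subseteq> RR d \<and> ediam d S \<le> ennreal (l / \<Gamma>) \<longrightarrow>
          finite (\<phi> ` S) \<and> real (card (\<phi> ` S)) \<le> \<Lambda>)"


section \<open>Programs on real inputs, with bit-counted working memory\<close>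

(* The model is a real RAM with floor in which real numbers cannot be stored.  A program has
     - a read-only array of real inputs,
     - a fixed finite set of integer variables (the working memory),
     - a write-only array of real outputs.
   Reals otherwise occur only as transient values of expressions, whose size is fixed by the
   program.  Space is the number of bits held in the integer variables, as in the usual
   convention for Turing machines with a read-only input and a write-only output tape.
   If reals could be stored, a single register could encode arbitrarily many bits and bounds
   on the space would be meaningless. *)

datatype expr =
    Const int
  | Var nat
  | Input expr
  | Add expr expr
  | Sub expr expr
  | Mul expr expr
  | Quot expr expr
  | Floor expr

datatype com =
    Assign nat expr
  | Output expr expr
  | Seq com com
  | Cond expr expr com com
  | Loop expr expr com

type_synonym store = "nat \<Rightarrow> int"

primrec eval_expr :: "(nat \<Rightarrow> real) \<Rightarrow> store \<Rightarrow> expr \<Rightarrow> real" where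
  "eval_expr inp s (Const n) = of_int n"
| "eval_expr inp s (Var v) = of_int (s v)"
| "eval_expr inp s (Input a) = inp (nat \<lfloor>eval_expr inp s a\<rfloor>)"
| "eval_expr inp s (Add a b) = eval_expr inp s a + eval_expr inp s b"
| "eval_expr inp s (Sub a b) = eval_expr inp s a - eval_expr inp s b"
| "eval_expr inp s (Mul a b) = eval_expr inp s a * eval_expr inp s b"
| "eval_expr inp s (Quot a b) = eval_expr inp s a / eval_expr inp s b"
| "eval_expr inp s (Floor a) = of_int \<lfloor>eval_expr inp s a\<rfloor>"

primrec vars_expr :: "expr \<Rightarrow> nat set" where
  "vars_expr (Const n) = {}"
| "vars_expr (Var v) = {v}"
| "vars_expr (Input a) = vars_expr a"
| "vars_expr (Add a b) = vars_expr a \<union> vars_expr b"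
| "vars_expr (Sub a b) = vars_expr a \<union> vars_expr b"
| "vars_expr (Mul a b) = vars_expr a \<union> vars_expr b"
| "vars_expr (Quot a b) = vars_expr a \<union> vars_expr b"
| "vars_expr (Floor a) = vars_expr a"

primrec vars_com :: "com \<Rightarrow> nat set" where
  "vars_com (Assign v a) = insert v (vars_expr a)"
| "vars_com (Output a b) = vars_expr a \<union> vars_expr b"
| "vars_com (Seq c1 c2) = vars_com c1 \<union> vars_com c2"
| "vars_com (Cond a b c1 c2) = vars_expr a \<union> vars_expr b \<union> vars_com c1 \<union> vars_com c2"
| "vars_com (Loop a b c) = vars_expr a \<union> vars_expr b \<union> vars_com c"

(* Binary digits of the absolute value, plus a sign bit. *)
definition int_bits :: "int \<Rightarrow> nat" where
  "int_bits n = floorlog 2 (nat \<bar>n\<bar>) + 1"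

definition store_bits :: "nat set \<Rightarrow> store \<Rightarrow> nat" where
  "store_bits V s = (\<Sum>v\<in>V. int_bits (s v))"

(* exec inp V c s out s' out' m: on real input inp, the command c terminates from store s and
   output array out in store s' and output array out'; m is the largest number of bits that
   the variables in V hold at any time of the run.  Cond and Loop test "a < b". *)
inductive exec ::
  "(nat \<Rightarrow> real) \<Rightarrow> nat set \<Rightarrow> com \<Rightarrow> store \<Rightarrow> (nat \<Rightarrow> real) \<Rightarrow> store \<Rightarrow> (nat \<Rightarrow> real) \<Rightarrow> nat \<Rightarrow> bool"
  for inp :: "nat \<Rightarrow> real" and V :: "nat set" where
  exec_Assign:
    "s' = s(v := \<lfloor>eval_expr inp s a\<rfloor>) \<Longrightarrow>
     exec inp V (Assign v a) s out s' out (max (store_bits V s) (store_bits V s'))"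
| exec_Output:
    "out' = out(nat \<lfloor>eval_expr inp s a\<rfloor> := eval_expr inp s b) \<Longrightarrow>
     exec inp V (Output a b) s out s out' (store_bits V s)"
| exec_Seq:
    "exec inp V c1 s out s' out' m1 \<Longrightarrow> exec inp V c2 s' out' s'' out'' m2 \<Longrightarrow>
     exec inp V (Seq c1 c2) s out s'' out'' (max m1 m2)"
| exec_Cond_True:
    "eval_expr inp s a < eval_expr inp s b \<Longrightarrow> exec inp V c1 s out s' out' m \<Longrightarrow>
     exec inp V (Cond a b c1 c2) s out s' out' m"
| exec_Cond_False:
    "\<not> eval_expr inp s a < eval_expr inp s b \<Longrightarrow> exec inp V c2 s out s' out' m \<Longrightarrow>
     exec inp V (Cond a b c1 c2) s out s' out' m"
| exec_Loop_False:
    "\<not> eval_expr inp s a < eval_expr inp s b \<Longrightarrow>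
     exec inp V (Loop a b c) s out s out (store_bits V s)"
| exec_Loop_True:
    "eval_expr inp s a < eval_expr inp s b \<Longrightarrow> exec inp V c s out s' out' m1 \<Longrightarrow>
     exec inp V (Loop a b c) s' out' s'' out'' m2 \<Longrightarrow>
     exec inp V (Loop a b c) s out s'' out'' (max m1 m2)"


section \<open>Evaluating a hash from its description\<close>

(* Variable 0 initially holds d and variable 1 the description w, read as a binary number
   (least significant bit first) with a leading 1 that marks the end of w.  The real inputs
   are l, \<Gamma>, x 0, x 1, ... in this order; the outputs must be the coordinates of y. *)
definition initial_store :: "nat \<Rightarrow> bool list \<Rightarrow> store" where
  "initial_store d w = (\<lambda>_. 0)(0 := int d, 1 := horner_sum of_bool 2 (w @ [True]))"

definition real_input :: "real \<Rightarrow> real \<Rightarrow> (nat \<Rightarrow> real) \<Rightarrow> nat \<Rightarrow> real" where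
  "real_input l \<Gamma> x = case_nat l (case_nat \<Gamma> x)"

definition evaluates_in_space ::
  "com \<Rightarrow> nat \<Rightarrow> real \<Rightarrow> real \<Rightarrow> bool list \<Rightarrow> (nat \<Rightarrow> real) \<Rightarrow> (nat \<Rightarrow> real) \<Rightarrow> real \<Rightarrow> bool" where
  "evaluates_in_space P d \<Gamma> l w x y B \<longleftrightarrow>
     (\<exists>s' m. exec (real_input l \<Gamma> x) (vars_com P) P (initial_store d w) (\<lambda>_. 0) s' y m \<and>
             real m \<le> B)"

end

theory Submission
  imports Defs
begin

text \<open>
  Round the input to the grid of mesh l / h with h = 1000 d^2 and identify grid vectors modulo the
  lattice of all v with sum v_k M^k = 0 mod Q, where M = 2 h + 1 and Q = M^d. The quotient is the
  cyclic group of order Q, and vectors with entries at most h in absolute value are recovered from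
  their residues as balanced base-M digits. Hence everything below happens with single integers
  below Q, although the grid itself is infinite.

  Choose radii R and R + \<Delta>, where \<Delta> is l / \<Gamma> up to rounding, such that the ball B of radius R + \<Delta>
  has at most E = exp (8 d / \<Gamma>) times as many points as the ball A of radius R; such R exists by
  pigeonhole, because tripling a radius multiplies the number of points by at most 5^d. Translates
  of the balls are indexed by the subset sums of T generators. A point is clean if the first
  translate of B that contains it also has it in the corresponding translate of A. Clean points at
  distance at most \<Delta> have the same first translate. By averaging over one new generator at a time,
  the generators can be chosen such that a fraction of at least 1 / (4 E) of all points is clean.
  Shifting the set of clean points by the subset sums of t further generators squares the uncovered
  fraction with every generator, so 2^t = O(E ln Q) shifts cover the group. The hash sends a point to
  the centre of the ball selected by the first shift that makes it clean; a set of diameter at most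
  l / \<Gamma> gets at most one value per shift. The description consists of the O(d ln d) generators of
  O(d ln d) bits each.
\<close>

section \<open>Grid vectors as residues\<close>

lemma sum_digits:
  fixes M Y :: int
  assumes "0 < M"
  shows "(\<Sum>k<n. (Y div M^k mod M) * M^k) = Y mod M^n"
proof (induction n)
  case (Suc n)
  have "Y mod (M^n * M) = M^n * (Y div M^n mod M) + Y mod M^n"
    using assms by (intro zmod_zmult2_eq) auto
  then show ?case using Suc by (simp add: mult.commute)
qed simp

text \<open>Uniqueness of base-\<open>M\<close> expansions, by induction on the number of digits:
  the new leading term cannot disturb the lower digits, and it fits below the next power because
  \<open>u n + 1 \<le> M\<close>.\<close>

lemma digit_sum:
  fixes M :: int and u :: "nat \<Rightarrow> int"
  assumes "\<And>k. k < n \<Longrightarrow> 0 \<le> u k \<and> u k < M"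
  shows "0 \<le> (\<Sum>k<n. u k * M^k) \<and> (\<Sum>k<n. u k * M^k) < M^n \<and>
         (\<forall>i<n. (\<Sum>k<n. u k * M^k) div M^i mod M = u i)"
  using assms
proof (induction n)
  case (Suc n)
  let ?S = "\<Sum>k<n. u k * M^k"
  have IH: "0 \<le> ?S" "?S < M^n" "\<And>i. i < n \<Longrightarrow> ?S div M^i mod M = u i"
    using Suc by auto
  have u: "0 \<le> u n" "u n < M" using Suc.prems by auto
  then have M: "0 < M" by linarith
  have "(u n + 1) * M^n \<le> M * M^n"
    using u M by (intro mult_right_mono) auto
  then have less: "?S + u n * M^n < M * M^n"
    using IH by (simp add: algebra_simps)
  have "(?S + u n * M^n) div M^i mod M = u i" if i: "i < Suc n" for i
  proof (cases "i = n")
    case True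
    then show ?thesis using IH u M by simp
  next
    case False
    \<comment> \<open>For \<open>i < n\<close> the leading term is \<open>M^i\<close> times a
      multiple of \<open>M\<close>, so it disappears after division by \<open>M^i\<close> and
      reduction modulo \<open>M\<close>.\<close>
    with i obtain e where e: "n = i + Suc e" by (metis less_SucE less_imp_Suc_add add_Suc_right)
    have "u n * M^n = M^i * (M * (u n * M^e))"
      by (simp add: e power_add)
    then have "(?S + u n * M^n) div M^i = M * (u n * M^e) + ?S div M^i"
      using M by (simp only: div_mult_self2) simp
    then show ?thesis using IH(3)[of i] e by simp
  qed
  then show ?case using IH u M less by auto
qed simp

text \<open>Balanced digit in base \<open>M = 2 * h + 1\<close>: adding the number all of whose
  digits are \<open>h\<close> turns digits in \<open>-h..h\<close> into ordinary ones in
  \<open>0..2 * h\<close>, and \<open>h\<close> is subtracted again after extraction.\<close>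

definition bdigit :: "int \<Rightarrow> nat \<Rightarrow> int \<Rightarrow> nat \<Rightarrow> int" where
  "bdigit h d a k =
     (a + ((2*h+1)^d - 1) div 2) mod (2*h+1)^d div (2*h+1)^k mod (2*h+1) - h"

text \<open>The halving is exact: all digits of \<open>M^d - 1\<close> equal
  \<open>M - 1 = 2 * h\<close>. This identifies the offset in \<open>bdigit\<close>.\<close>

lemma half_power_eq:
  fixes h :: int
  shows "((2*h+1)^d - 1) div 2 = (\<Sum>k<d. h * (2*h+1)^k)"
proof -
  have "(2*h+1)^d - 1 = 2 * (\<Sum>k<d. h * (2*h+1)^k)"
    by (induction d) (auto simp: algebra_simps)
  then show ?thesis by simp
qed

lemma bdigit_bounds:
  assumes "0 \<le> h"
  shows "\<bar>bdigit h d a k\<bar> \<le> h"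
proof -
  have "0 \<le> x mod (2*h+1)" "x mod (2*h+1) < 2*h+1" for x
    using assms by (intro pos_mod_sign pos_mod_bound; linarith)+
  then have "0 \<le> bdigit h d a k + h" "bdigit h d a k + h < 2*h+1"
    unfolding bdigit_def by (metis diff_add_cancel)+
  then show ?thesis by linarith
qed

lemma bdigit_cong: "a mod (2*h+1)^d = b mod (2*h+1)^d \<Longrightarrow> bdigit h d a k = bdigit h d b k"
  unfolding bdigit_def by (metis mod_add_left_eq)

text \<open>The subtracted \<open>h\<close> in every digit sum up to exactly the offset added at the
  start, so only the ordinary reassembly of digits remains.\<close>

lemma sum_bdigit:
  assumes "0 \<le> h"
  shows "(\<Sum>k<d. bdigit h d a k * (2*h+1)^k) mod (2*h+1)^d = a mod (2*h+1)^d"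
proof -
  define M c where M_def: "M = 2*h+1" and c_def: "c = ((2*h+1)^d - 1) div 2"
  define Y where "Y = (a + c) mod M^d"
  have M: "0 < M" using assms by (simp add: M_def)
  have c: "c = (\<Sum>k<d. h * M^k)" unfolding c_def M_def by (rule half_power_eq)
  have "(\<Sum>k<d. bdigit h d a k * M^k) = (\<Sum>k<d. (Y div M^k mod M) * M^k) - c"
    unfolding bdigit_def M_def[symmetric] Y_def c_def[folded M_def, symmetric]
    by (simp only: left_diff_distrib sum_subtractf c[symmetric])
  also have "\<dots> = Y mod M^d - c"
    by (simp only: sum_digits[OF M])
  also have "\<dots> mod M^d = a mod M^d"
    unfolding Y_def by (simp add: mod_simps)
  finally show ?thesis unfolding M_def .
qed

text \<open>With the offset added, the entries become \<open>v k + h\<close> in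
  \<open>{0..<M}\<close>, and uniqueness of ordinary expansions applies. This is how short grid
  vectors are recovered from their residues.\<close>

lemma bdigit_unique:
  assumes v: "\<And>k. k < d \<Longrightarrow> \<bar>v k\<bar> \<le> h"
    and a: "a mod (2*h+1)^d = (\<Sum>k<d. v k * (2*h+1)^k) mod (2*h+1)^d"
    and "k < d"
  shows "bdigit h d a k = v k"
proof -
  define M c where "M = 2*h+1" and "c = ((2*h+1)^d - 1) div 2"
  have c: "c = (\<Sum>k<d. h * M^k)" unfolding c_def M_def by (rule half_power_eq)
  have u: "0 \<le> v k + h \<and> v k + h < M" if "k < d" for k
    using v[OF that] unfolding M_def by linarith
  note D = digit_sum[of d "\<lambda>k. v k + h" M, OF u]
  have "(a + c) mod M^d = ((\<Sum>k<d. v k * M^k) + c) mod M^d"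
    using a unfolding M_def by (metis mod_add_left_eq)
  also have "(\<Sum>k<d. v k * M^k) + c = (\<Sum>k<d. (v k + h) * M^k)"
    unfolding c by (simp only: distrib_right sum.distrib)
  also have "\<dots> mod M^d = \<dots>" using D by (intro mod_pos_pos_trivial) auto
  finally have "(a + c) mod M^d div M^k mod M = v k + h"
    using D \<open>k < d\<close> by simp
  then show ?thesis unfolding bdigit_def M_def c_def by simp
qed

section \<open>Covering a cyclic group by subset sums\<close>

text \<open>The binary digits of \<open>j\<close>, least significant first, select the generators of
  a subset sum. The indices thus also put the subset sums in an order, which matters for "first
  translate".\<close>

primrec shift :: "int list \<Rightarrow> nat \<Rightarrow> int" where
  "shift [] j = 0"
| "shift (z # zs) j = int (j mod 2) * z + shift zs (j div 2)"

lemma shift_0 [simp]: "shift zs 0 = 0"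
  by (induction zs) auto

text \<open>Low bits of an index address the first list and high bits the second. So the indices
  fall into consecutive blocks, each of which is one shift of the whole family given by
  \<open>zs\<close>.\<close>

lemma shift_append:
  "j < 2 ^ length zs \<Longrightarrow> shift (zs @ ws) (j + 2 ^ length zs * i) = shift zs j + shift ws i"
proof (induction zs arbitrary: j)
  case (Cons z zs)
  have "(j + 2 * 2 ^ length zs * i) div 2 = j div 2 + 2 ^ length zs * i"
    "(j + 2 * 2 ^ length zs * i) mod 2 = j mod 2"
    by (simp_all add: mult.assoc)
  then show ?case using Cons.IH[of "j div 2"] Cons.prems by auto
qed simp

definition covered :: "int \<Rightarrow> int set \<Rightarrow> int list \<Rightarrow> int set" where
  "covered Q B zs = {a \<in> {0..<Q}. \<exists>j<2 ^ length zs. (a - shift zs j) mod Q \<in> B}"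

text \<open>For \<open>A \<subseteq> B\<close> the witness \<open>j\<close> is the first index whose
  translate of \<open>B\<close> contains the point.\<close>

definition clean :: "int \<Rightarrow> int set \<Rightarrow> int set \<Rightarrow> int list \<Rightarrow> int set" where
  "clean Q A B zs = {a \<in> {0..<Q}. \<exists>j<2 ^ length zs. (a - shift zs j) mod Q \<in> A \<and>
                      (\<forall>i<j. (a - shift zs i) mod Q \<notin> B)}"

lemma shift_snoc:
  assumes "j < 2 ^ length zs"
  shows "shift (zs @ [z]) j = shift zs j" "shift (zs @ [z]) (j + 2 ^ length zs) = shift zs j + z"
  using shift_append[OF assms, of "[z]" 0] shift_append[OF assms, of "[z]" 1] by simp_all

lemma less_double_cases:
  fixes j :: nat
  assumes "j < 2 ^ Suc n"
  obtains "j < 2 ^ n" | i where "j = i + 2 ^ n" "i < 2 ^ n"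
proof (cases "j < 2 ^ n")
  case False
  then have "j = (j - 2 ^ n) + 2 ^ n" "j - 2 ^ n < 2 ^ n" using assms by auto
  then show ?thesis using that(2) by blast
qed (use that in blast)

lemma shift_snoc_mod:
  assumes "j < 2 ^ length zs"
  shows "(a - shift (zs @ [z]) (j + 2 ^ length zs)) mod Q = ((a - z) mod Q - shift zs j) mod Q"
  by (simp add: shift_snoc[OF assms] mod_simps algebra_simps)

text \<open>The new generator is governed by the top bit of the index: bit 0 gives the old
  translates, bit 1 their shifts by \<open>z\<close>.\<close>

lemma covered_snoc:
  assumes "0 < Q"
  shows "covered Q B (zs @ [z]) =
    covered Q B zs \<union> {a \<in> {0..<Q}. (a - z) mod Q \<in> covered Q B zs}" (is "?L = ?R")
proof
  show "?L \<subseteq> ?R"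
  proof
    fix a assume "a \<in> ?L"
    then obtain j where a: "a \<in> {0..<Q}" and j: "j < 2 ^ Suc (length zs)"
      "(a - shift (zs @ [z]) j) mod Q \<in> B"
      by (auto simp: covered_def)
    from j(1) show "a \<in> ?R"
    proof (cases rule: less_double_cases)
      case 1
      then show ?thesis using a j shift_snoc(1)[OF 1, of z] by (auto simp: covered_def)
    next
      case (2 i)
      then show ?thesis using a j assms shift_snoc_mod[OF 2(2), of a z Q]
        by (auto simp: covered_def)
    qed
  qed
  show "?R \<subseteq> ?L"
  proof
    fix a assume "a \<in> ?R"
    then consider j where "a \<in> {0..<Q}" "j < 2 ^ length zs" "(a - shift zs j) mod Q \<in> B"
      | j where "a \<in> {0..<Q}" "j < 2 ^ length zs" "((a - z) mod Q - shift zs j) mod Q \<in> B"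
      by (auto simp: covered_def)
    then show "a \<in> ?L"
    proof cases
      case 1
      then show ?thesis using shift_snoc(1)[OF 1(2), of z]
        by (auto simp: covered_def intro!: exI[of _ j])
    next
      case 2
      then show ?thesis using shift_snoc_mod[OF 2(2), of a z Q]
        by (auto simp: covered_def intro!: exI[of _ "j + 2 ^ length zs"])
    qed
  qed
qed

text \<open>All old indices precede the new ones. So a clean point stays clean, and a point outside
  all old translates is judged by the new ones alone, that is, by its shift by
  \<open>-z\<close>.\<close>

lemma clean_snoc:
  assumes "0 < Q"
  shows "clean Q A B zs \<union> {a \<in> {0..<Q} - covered Q B zs. (a - z) mod Q \<in> clean Q A B zs}
    \<subseteq> clean Q A B (zs @ [z])"
proof
  fix a
  assume "a \<in> clean Q A B zs \<union> {a \<in> {0..<Q} - covered Q B zs. (a - z) mod Q \<in> clean Q A B zs}"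
  then consider "a \<in> clean Q A B zs"
    | "a \<in> {0..<Q}" "a \<notin> covered Q B zs" "(a - z) mod Q \<in> clean Q A B zs" by auto
  then show "a \<in> clean Q A B (zs @ [z])"
  proof cases
    case 1
    then obtain j where "a \<in> {0..<Q}" and j: "j < 2 ^ length zs" "(a - shift zs j) mod Q \<in> A"
       "\<And>i. i < j \<Longrightarrow> (a - shift zs i) mod Q \<notin> B"
      by (auto simp: clean_def)
    moreover have "shift (zs @ [z]) i = shift zs i" if "i \<le> j" for i
      using that j(1) by (intro shift_snoc) auto
    ultimately show ?thesis
      by (auto simp: clean_def intro!: exI[of _ j])
  next
    case 2
    then obtain j where j: "j < 2 ^ length zs" "((a - z) mod Q - shift zs j) mod Q \<in> A"
       "\<And>i. i < j \<Longrightarrow> ((a - z) mod Q - shift zs i) mod Q \<notin> B"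
      by (auto simp: clean_def)
    have "(a - shift (zs @ [z]) i) mod Q \<notin> B" if i: "i < j + 2 ^ length zs" for i
    proof -
      have "i < 2 ^ Suc (length zs)" using i j(1) by simp
      then show ?thesis
      proof (cases rule: less_double_cases)
        case 1
        then show ?thesis using 2 shift_snoc(1)[OF 1, of z] by (auto simp: covered_def)
      next
        case (2 i')
        then show ?thesis using i j(3)[of i'] shift_snoc_mod[OF 2(2), of a z Q] by auto
      qed
    qed
    then show ?thesis
      using 2 j shift_snoc_mod[OF j(1), of a z Q]
      by (auto simp: clean_def intro!: exI[of _ "j + 2 ^ length zs"])
  qed
qed

text \<open>Double counting: a pair of \<open>z\<close> and \<open>a\<close> corresponds to the pair
  of \<open>a\<close> and \<open>x = (a - z) mod Q\<close>, and every \<open>x\<close> in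
  \<open>X\<close> arises from exactly one \<open>z\<close>.\<close>

lemma sum_card_translates:
  fixes Q :: int
  assumes "0 < Q" "U \<subseteq> {0..<Q}" "X \<subseteq> {0..<Q}"
  shows "(\<Sum>z\<in>{0..<Q}. card {a \<in> U. (a - z) mod Q \<in> X}) = card U * card X"
proof -
  have fin: "finite U" "finite X" using assms finite_subset by auto
  have "(\<Sum>z\<in>{0..<Q}. card {a \<in> U. (a - z) mod Q \<in> X}) =
        card (SIGMA z:{0..<Q}. {a \<in> U. (a - z) mod Q \<in> X})"
    using fin by (subst card_SigmaI) auto
  also have "\<dots> = card (U \<times> X)"
  proof (intro bij_betw_same_card[of "\<lambda>(z, a). (a, (a - z) mod Q)"]
      bij_betw_byWitness[where f' = "\<lambda>(a, x). ((a - x) mod Q, a)"])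
    show "\<forall>p\<in>SIGMA z:{0..<Q}. {a \<in> U. (a - z) mod Q \<in> X}.
       (\<lambda>(a, x). ((a - x) mod Q, a)) ((\<lambda>(z, a). (a, (a - z) mod Q)) p) = p"
      by (auto simp: mod_simps)
    show "\<forall>p\<in>U \<times> X. (\<lambda>(z, a). (a, (a - z) mod Q)) ((\<lambda>(a, x). ((a - x) mod Q, a)) p) = p"
      using assms by (auto simp: mod_simps)
    show "(\<lambda>(z, a). (a, (a - z) mod Q)) ` (SIGMA z:{0..<Q}. {a \<in> U. (a - z) mod Q \<in> X}) \<subseteq> U \<times> X"
      by auto
    show "(\<lambda>(a, x). ((a - x) mod Q, a)) ` (U \<times> X) \<subseteq> (SIGMA z:{0..<Q}. {a \<in> U. (a - z) mod Q \<in> X})"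
      using assms by (auto simp: mod_simps)
  qed
  also have "\<dots> = card U * card X" by (simp add: card_cartesian_product)
  finally show ?thesis .
qed

lemma exists_ge_average:
  fixes f :: "int \<Rightarrow> real"
  assumes "0 < Q" "real_of_int Q * c \<le> (\<Sum>z\<in>{0..<Q}. f z)"
  shows "\<exists>z\<in>{0..<Q}. c \<le> f z"
proof (rule ccontr)
  assume "\<not> ?thesis"
  then have "(\<Sum>z\<in>{0..<Q}. f z) < (\<Sum>z\<in>{0..<Q}. c)"
    using assms by (intro sum_strict_mono) (auto simp: not_le)
  then show False using assms by simp
qed

text \<open>
  A random new generator multiplies both the clean and the covered part by 1 + u on average, where u
  is the uncovered fraction. So the linear functional F grows by the factor 1 + u, which is at least
  3/2 until half of the group is covered; and F > 0 bounds the clean part from below by the covered one.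
\<close>

lemma exists_good_doubling:
  fixes Q :: int
  assumes Q: "0 < Q" and "A \<subseteq> B" and B: "B \<subseteq> {0..<Q}" and "A \<noteq> {}"
  defines "F \<equiv> (\<lambda>zs. 2 * real (card B) * real (card (clean Q A B zs))
                    - real (card A) * real (card (covered Q B zs)))"
  shows "\<exists>zs. length zs = n \<and> set zs \<subseteq> {0..<Q} \<and> 0 < F zs \<and>
           (Q \<le> 2 * int (card (covered Q B zs)) \<or> (3/2)^n \<le> F zs)"
proof (induction n)
  case 0
  have "finite B" using B finite_subset by auto
  then have fin: "finite A" "finite B" using \<open>A \<subseteq> B\<close> finite_subset by auto
  have "clean Q A B [] = A" "covered Q B [] = B"
    using \<open>A \<subseteq> B\<close> B by (auto simp: clean_def covered_def mod_pos_pos_trivial)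
  \<comment> \<open>The factor 2 in \<open>F\<close> leaves one copy of
    \<open>card A * card B\<close>, a positive integer and hence at least 1.\<close>
  then have "F [] = real (card A * card B)"
    by (simp add: F_def)
  moreover have "0 < card A * card B"
    using fin \<open>A \<noteq> {}\<close> \<open>A \<subseteq> B\<close> by (auto simp: card_gt_0_iff)
  then have "1 \<le> real (card A * card B)"
    by linarith
  ultimately have "0 < F []" "(3/2)^0 \<le> F []" by simp_all
  then show ?case by (intro exI[of _ "[]"]) simp
next
  case (Suc n)
  then obtain zs where zs: "length zs = n" "set zs \<subseteq> {0..<Q}" "0 < F zs"
    "Q \<le> 2 * int (card (covered Q B zs)) \<or> (3/2)^n \<le> F zs" by blast
  let ?C = "covered Q B zs" and ?G = "clean Q A B zs" and ?U = "{0..<Q} - covered Q B zs"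
  have sub: "?C \<subseteq> {0..<Q}" "?G \<subseteq> {0..<Q}" by (auto simp: covered_def clean_def)
  then have fin: "finite ?C" "finite ?G" using finite_subset by auto
  have GC: "?G \<subseteq> ?C" using \<open>A \<subseteq> B\<close> by (auto simp: covered_def clean_def)
  have Ucard: "real (card ?U) = of_int Q - real (card ?C)"
  proof -
    have "card ?U = nat Q - card ?C" using sub fin by (subst card_Diff_subset) auto
    moreover have "card ?C \<le> nat Q" using card_mono[OF _ sub(1)] by simp
    ultimately show ?thesis using Q by simp
  qed
  define g where "g z = card {a \<in> ?U. (a - z) mod Q \<in> ?G}" for z
  define c where "c z = card {a \<in> ?U. (a - z) mod Q \<in> ?C}" for z
  have sumg: "(\<Sum>z\<in>{0..<Q}. real (g z)) = real (card ?U) * real (card ?G)"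
    and sumc: "(\<Sum>z\<in>{0..<Q}. real (c z)) = real (card ?U) * real (card ?C)"
    using sum_card_translates[OF Q, of ?U ?G] sum_card_translates[OF Q, of ?U ?C] sub
    unfolding g_def c_def by (simp_all flip: of_nat_sum of_nat_mult)
  have covz: "card (covered Q B (zs @ [z])) = card ?C + c z" for z
  proof -
    have eq: "covered Q B (zs @ [z]) = ?C \<union> {a \<in> ?U. (a - z) mod Q \<in> ?C}"
      using covered_snoc[OF Q] by blast
    have "finite {a \<in> ?U. (a - z) mod Q \<in> ?C}"
      by (rule finite_subset[of _ "{0..<Q}"]) auto
    then show ?thesis unfolding c_def eq using fin by (subst card_Un_disjoint) auto
  qed
  have clz: "card ?G + g z \<le> card (clean Q A B (zs @ [z]))" for z
  proof -
    have "finite {a \<in> ?U. (a - z) mod Q \<in> ?G}"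
      by (rule finite_subset[of _ "{0..<Q}"]) auto
    then have "card ?G + g z = card (?G \<union> {a \<in> ?U. (a - z) mod Q \<in> ?G})"
      unfolding g_def using fin GC by (subst card_Un_disjoint) auto
    also have "\<dots> \<le> card (clean Q A B (zs @ [z]))"
    proof (rule card_mono)
      show "finite (clean Q A B (zs @ [z]))"
        by (rule finite_subset[of _ "{0..<Q}"]) (auto simp: clean_def)
      show "?G \<union> {a \<in> ?U. (a - z) mod Q \<in> ?G} \<subseteq> clean Q A B (zs @ [z])"
        by (rule clean_snoc[OF Q])
    qed
    finally show ?thesis .
  qed
  let ?f = "\<lambda>z. 2 * real (card B) * real (card ?G + g z) - real (card A) * real (card ?C + c z)"
  have "(\<Sum>z\<in>{0..<Q}. ?f z) =
      2 * real (card B) * (of_int Q * real (card ?G) + (\<Sum>z\<in>{0..<Q}. real (g z)))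
      - real (card A) * (of_int Q * real (card ?C) + (\<Sum>z\<in>{0..<Q}. real (c z)))"
    using Q by (simp add: sum_subtractf sum.distrib flip: sum_distrib_left)
  \<comment> \<open>Both expected gains carry the same factor \<open>card ?U\<close>, so the whole
    sum is a multiple of \<open>F zs\<close>.\<close>
  also have "\<dots> = (of_int Q + real (card ?U)) * F zs"
    unfolding sumg sumc F_def by (simp only: algebra_simps)
  finally have "(\<Sum>z\<in>{0..<Q}. ?f z) = (of_int Q + real (card ?U)) * F zs" .
  then have "of_int Q * ((of_int Q + real (card ?U)) * F zs / of_int Q) \<le> (\<Sum>z\<in>{0..<Q}. ?f z)"
    using Q by simp
  from exists_ge_average[OF Q this]
  obtain z where z: "z \<in> {0..<Q}" "(of_int Q + real (card ?U)) * F zs / of_int Q \<le> ?f z"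
    by blast
  have fF: "?f z \<le> F (zs @ [z])"
    unfolding F_def covz using clz[of z] by (simp add: mult_left_mono del: of_nat_add)
  have eq: "(of_int Q + real (card ?U)) * F zs / of_int Q = (1 + real (card ?U) / of_int Q) * F zs"
    using Q by (simp add: field_simps)
  have "F zs \<le> (of_int Q + real (card ?U)) * F zs / of_int Q"
    unfolding eq using zs(3) Q by (simp add: distrib_right)
  with z fF zs(3) have pos: "0 < F (zs @ [z])" by linarith
  have "Q \<le> 2 * int (card (covered Q B (zs @ [z]))) \<or> (3/2)^Suc n \<le> F (zs @ [z])"
  proof (cases "Q \<le> 2 * int (card ?C)")
    case True
    then show ?thesis unfolding covz by simp
  next
    case False
    then have F: "(3/2)^n \<le> F zs" using zs by simp
    \<comment> \<open>Less than half is covered, so the growth factor is at least 3/2.\<close>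
    from False have "1/2 \<le> real (card ?U) / of_int Q"
      unfolding Ucard using Q by (simp add: field_simps)
    then have "(3/2) * F zs \<le> (1 + real (card ?U) / of_int Q) * F zs"
      using zs(3) by (intro mult_right_mono) auto
    with F z fF show ?thesis unfolding eq power_Suc by linarith
  qed
  then show ?case using zs z pos by (intro exI[of _ "zs @ [z]"]) auto
qed

text \<open>A point stays uncovered only if both it and its shift by \<open>-z\<close> were
  uncovered. On average over \<open>z\<close> this squares the uncovered fraction.\<close>

lemma exists_covering_doubling:
  fixes Q :: int
  assumes Q: "0 < Q" and X: "X \<subseteq> {0..<Q}"
  shows "\<exists>zs. length zs = n \<and> set zs \<subseteq> {0..<Q} \<and>
           real (card ({0..<Q} - covered Q X zs)) \<le> of_int Q * (1 - real (card X) / of_int Q)^(2^n)"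
proof (induction n)
  case 0
  have "covered Q X [] = X" using X by (auto simp: covered_def)
  moreover have "card ({0..<Q} - X) = nat Q - card X" "card X \<le> nat Q"
    using X card_mono[OF _ X] finite_subset[OF X] by (auto simp: card_Diff_subset)
  ultimately show ?case using Q by (intro exI[of _ "[]"]) (auto simp: field_simps)
next
  case (Suc n)
  then obtain zs where zs: "length zs = n" "set zs \<subseteq> {0..<Q}"
    "real (card ({0..<Q} - covered Q X zs)) \<le> of_int Q * (1 - real (card X) / of_int Q)^(2^n)"
    by blast
  let ?U = "{0..<Q} - covered Q X zs"
  have "(\<Sum>z\<in>{0..<Q}. real (card {a \<in> ?U. (a - z) mod Q \<in> ?U})) = real (card ?U) * real (card ?U)"
    using sum_card_translates[OF Q, of ?U ?U] by (simp flip: of_nat_sum of_nat_mult)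
  then obtain z where z: "z \<in> {0..<Q}"
    \<comment> \<open>Negation turns the averaging lemma into the existence of a value that is at
      most the average.\<close>
    "- (real (card ?U) * real (card ?U) / of_int Q) \<le> - real (card {a \<in> ?U. (a - z) mod Q \<in> ?U})"
    using exists_ge_average[OF Q, of "- (real (card ?U) * real (card ?U) / of_int Q)"
        "\<lambda>z. - real (card {a \<in> ?U. (a - z) mod Q \<in> ?U})"] Q
    by (auto simp: sum_negf)
  have "{0..<Q} - covered Q X (zs @ [z]) = {a \<in> ?U. (a - z) mod Q \<in> ?U}"
    unfolding covered_snoc[OF Q] using Q by auto
  then have "real (card ({0..<Q} - covered Q X (zs @ [z]))) \<le> real (card ?U) * real (card ?U) / of_int Q"
    using z by simp
  also have "\<dots> \<le> (of_int Q * (1 - real (card X) / of_int Q)^(2^n)) * (of_int Q * (1 - real (card X) / of_int Q)^(2^n)) / of_int Q"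
    using zs(3) Q by (intro divide_right_mono mult_mono) (auto intro: order_trans[OF of_nat_0_le_iff])
  also have "\<dots> = of_int Q * (1 - real (card X) / of_int Q)^(2^Suc n)"
    using Q by (simp add: mult_2 power_add)
  finally show ?case using zs z by (intro exI[of _ "zs @ [z]"]) auto
qed

text \<open>Two stages. The generators \<open>zs\<close> make a fraction
  \<open>g > 1 / (4 * E)\<close> of the group clean; then \<open>ws\<close> leave fewer than
  \<open>Q * exp (- (2^t * g)) < 1\<close> points without a clean shift.\<close>

lemma exists_shifts:
  fixes Q :: int and E :: real
  assumes Q: "0 < Q" and AB: "A \<subseteq> B" and B: "B \<subseteq> {0..<Q}" and A: "A \<noteq> {}"
    and E: "real (card B) \<le> E * real (card A)"
    and T: "2 * (real_of_int Q)\<^sup>2 < (3/2)^T" and t: "4 * E * ln (real_of_int Q) < 2^t"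
  shows "\<exists>zs ws. length zs = T \<and> length ws = t \<and> set zs \<subseteq> {0..<Q} \<and> set ws \<subseteq> {0..<Q} \<and>
           (\<forall>a\<in>{0..<Q}. \<exists>j<2^t. (a - shift ws j) mod Q \<in> clean Q A B zs)"
proof -
  have fin: "finite B" "finite A" using B AB finite_subset by (auto intro: finite_subset)
  have cA: "0 < real (card A)" using fin A by (simp add: card_gt_0_iff)
  also have "real (card A) \<le> real (card B)" using AB fin by (simp add: card_mono)
  finally have "0 < E * real (card A)" using E by linarith
  then have E0: "0 < E" using cA by (simp add: zero_less_mult_iff)
  obtain zs where zs: "length zs = T" "set zs \<subseteq> {0..<Q}"
    "real (card A) * real (card (covered Q B zs)) < 2 * real (card B) * real (card (clean Q A B zs))"
    "Q \<le> 2 * int (card (covered Q B zs)) \<or>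
     (3/2)^T \<le> 2 * real (card B) * real (card (clean Q A B zs))
                - real (card A) * real (card (covered Q B zs))"
    using exists_good_doubling[OF Q AB B A, of T] by auto
  let ?G = "clean Q A B zs"
  have le_Q: "real (card X) \<le> of_int Q" if "X \<subseteq> {0..<Q}" for X
    using card_mono[OF _ that] Q by simp
  have G: "?G \<subseteq> {0..<Q}" by (auto simp: clean_def)
  \<comment> \<open>This caps \<open>F\<close> by \<open>2 * Q^2\<close>, which is below
    \<open>(3/2)^T\<close>. So exponential growth is ruled out and half of the group must be
    covered.\<close>
  have "real (card B) * real (card ?G) \<le> of_int Q * of_int Q"
    using le_Q[OF B] le_Q[OF G] Q by (intro mult_mono) auto
  moreover have "0 \<le> real (card A) * real (card (covered Q B zs))" by simp
  ultimately have "Q \<le> 2 * int (card (covered Q B zs))"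
    using zs(4) T unfolding power2_eq_square by linarith
  then have "of_int Q \<le> 2 * real (card (covered Q B zs))" by linarith
  then have "real (card A) * of_int Q \<le> real (card A) * (2 * real (card (covered Q B zs)))"
    by (intro mult_left_mono) auto
  also have "\<dots> < 4 * real (card B) * real (card ?G)"
    using zs(3) by linarith
  also have "\<dots> \<le> 4 * (E * real (card A)) * real (card ?G)"
    using E by (intro mult_right_mono) auto
  finally have "real (card A) * of_int Q < real (card A) * (4 * E * real (card ?G))"
    by (simp only: mult_ac)
  then have cG: "1 / (4 * E) < real (card ?G) / of_int Q"
    using cA E0 Q by (simp add: field_simps)
  obtain ws where ws: "length ws = t" "set ws \<subseteq> {0..<Q}"
    "real (card ({0..<Q} - covered Q ?G ws)) \<le> of_int Q * (1 - real (card ?G) / of_int Q)^(2^t)"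
    using exists_covering_doubling[OF Q G] by blast
  define g where "g = real (card ?G) / of_int Q"
  have "g \<le> 1" using le_Q[OF G] Q by (simp add: g_def)
  have "ln (of_int Q) < 2^t * (1 / (4 * E))"
    using t E0 by (simp add: field_simps)
  also have "\<dots> \<le> 2^t * g" using cG unfolding g_def by (intro mult_left_mono) auto
  finally have less: "ln (of_int Q) < 2^t * g" .
  have "(1 - g)^(2^t) \<le> exp (- g)^(2^t)"
    using exp_ge_add_one_self[of "- g"] \<open>g \<le> 1\<close> by (intro power_mono) auto
  also have "\<dots> = exp (- (2^t * g))" by (simp add: exp_of_nat_mult[symmetric])
  also have "\<dots> < exp (- ln (of_int Q))" using less by simp
  also have "\<dots> = 1 / of_int Q" using Q by (simp add: exp_minus inverse_eq_divide)
  finally have "of_int Q * (1 - g)^(2^t) < 1"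
    using Q by (simp add: field_simps)
  \<comment> \<open>A cardinality below 1 is 0.\<close>
  then have "card ({0..<Q} - covered Q ?G ws) = 0"
    using ws(3) unfolding g_def by linarith
  then have "{0..<Q} \<subseteq> covered Q ?G ws" by auto
  then show ?thesis using zs ws by (intro exI[of _ zs] exI[of _ ws]) (auto simp: covered_def)
qed

text \<open>Indices are grouped into blocks of length \<open>S\<close>, and \<open>j\<close> must be
  the first touch within its own block. The predicates are abstract so that the notion applies both
  to residues in \<open>A\<close> and \<open>B\<close> and to the norms that the program
  compares.\<close>

definition wins :: "nat \<Rightarrow> (nat \<Rightarrow> bool) \<Rightarrow> (nat \<Rightarrow> bool) \<Rightarrow> nat \<Rightarrow> bool" where
  "wins S hit touch j \<longleftrightarrow> hit j \<and> (\<forall>i<j. i div S = j div S \<longrightarrow> \<not> touch i)"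

text \<open>The winning index has the shift \<open>j\<close> that makes the point clean as its high
  part and the clean witness as its low part.\<close>

lemma exists_wins:
  assumes "j < 2 ^ length ws" and "(a - shift ws j) mod Q \<in> clean Q A B zs"
  shows "\<exists>i<2 ^ length (zs @ ws). wins (2 ^ length zs) (\<lambda>i. (a - shift (zs @ ws) i) mod Q \<in> A)
            (\<lambda>i. (a - shift (zs @ ws) i) mod Q \<in> B) i"
proof -
  let ?S = "2 ^ length zs :: nat"
  have sh: "(a - shift (zs @ ws) (i + ?S * j)) mod Q = ((a - shift ws j) mod Q - shift zs i) mod Q"
    if "i < ?S" for i
    unfolding shift_append[OF that] by (simp add: mod_simps algebra_simps)
  obtain i where i: "i < ?S" "((a - shift ws j) mod Q - shift zs i) mod Q \<in> A"
    "\<And>i'. i' < i \<Longrightarrow> ((a - shift ws j) mod Q - shift zs i') mod Q \<notin> B"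
    using assms(2) by (auto simp: clean_def)
  have "i + ?S * j < ?S + ?S * j" using i(1) by simp
  also have "\<dots> = ?S * (j + 1)" by simp
  also have "\<dots> \<le> ?S * 2 ^ length ws" using assms(1) by (intro mult_le_mono2) auto
  finally have "i + ?S * j < 2 ^ length (zs @ ws)" by (simp add: power_add)
  moreover have "(a - shift (zs @ ws) k) mod Q \<notin> B" if "k < i + ?S * j" "k div ?S = (i + ?S * j) div ?S" for k
  proof -
    have "(i + ?S * j) div ?S = j" using i(1) by simp
    \<comment> \<open>Lying in the same block means having the same high part, so only the low parts
      are compared.\<close>
    then have k: "k mod ?S + ?S * j = k" using that(2) by (metis mod_mult_div_eq)
    then have "k mod ?S < i" using that(1) by linarith
    then show ?thesis using i(3)[of "k mod ?S"] sh[of "k mod ?S"] k by simp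
  qed
  ultimately show ?thesis
    using i(2) sh[OF i(1)] by (auto simp: wins_def intro!: exI[of _ "i + ?S * j"])
qed

section \<open>Balls of grid vectors\<close>

text \<open>The box \<open>-h..h\<close> is the range of balanced digits; extensional functions make
  the set finite, so that it can be counted.\<close>

definition zball :: "nat \<Rightarrow> int \<Rightarrow> real \<Rightarrow> (nat \<Rightarrow> int) set" where
  "zball d h R = {v \<in> {..<d} \<rightarrow>\<^sub>E {-h..h}. L2_set (\<lambda>k. real_of_int (v k)) {..<d} \<le> R}"

lemma finite_zball: "finite (zball d h R)"
proof (rule finite_subset)
  show "zball d h R \<subseteq> {..<d} \<rightarrow>\<^sub>E {-h..h}" unfolding zball_def by blast
  show "finite ({..<d} \<rightarrow>\<^sub>E {-h..h})" by (rule finite_PiE) simp_all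
qed

lemma zball_mono: "R \<le> R' \<Longrightarrow> zball d h R \<subseteq> zball d h R'"
  unfolding zball_def by (blast intro: order_trans)

text \<open>Rounds towards zero, so that dividing a vector by 3 cannot leave a smaller ball.\<close>

definition third :: "int \<Rightarrow> int" where
  "third x = (if 0 \<le> x then x div 3 else - ((- x) div 3))"

lemma third_pos: "0 \<le> x \<Longrightarrow> 3 * third x \<le> x \<and> x - 2 \<le> 3 * third x \<and> 0 \<le> third x"
  unfolding third_def by presburger
lemma third_minus: "third (- x) = - third x"
  by (cases x "0::int" rule: linorder_cases) (simp_all add: third_def)
lemma third_bounds: "3 * \<bar>third x\<bar> \<le> \<bar>x\<bar>" "x - 3 * third x \<in> {-2..2}"
  using third_pos[of x] third_pos[of "-x"] third_minus[of x] unfolding atLeastAtMost_iff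
  by linarith+

text \<open>A vector is determined by its rounded third, which lies in the smaller ball, and its
  remainder, whose entries have the 5 possible values \<open>-2..2\<close>.\<close>

lemma card_zball_triple: "card (zball d h (3 * R)) \<le> 5 ^ d * card (zball d h R)"
proof -
  let ?P = "{..<d} \<rightarrow>\<^sub>E {-2..2::int}"
  let ?f = "\<lambda>v. (restrict (\<lambda>k. v k - 3 * third (v k)) {..<d}, restrict (\<lambda>k. third (v k)) {..<d})"
  have "card (zball d h (3 * R)) \<le> card (?P \<times> zball d h R)"
  proof (rule card_inj_on_le)
    show "inj_on ?f (zball d h (3 * R))"
    proof (rule inj_onI)
      fix v w assume "v \<in> zball d h (3 * R)" "w \<in> zball d h (3 * R)" and eq: "?f v = ?f w"
      then have ext: "v \<in> extensional {..<d}" "w \<in> extensional {..<d}"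
        by (auto simp: zball_def PiE_def)
      have "v k = w k" if "k < d" for k
      proof -
        have "v k - 3 * third (v k) = w k - 3 * third (w k)" "third (v k) = third (w k)"
          using that arg_cong[OF eq, of "\<lambda>p. fst p k"] arg_cong[OF eq, of "\<lambda>p. snd p k"] by simp_all
        then show ?thesis by simp
      qed
      then show "v = w" using ext by (intro extensionalityI[of v "{..<d}"]) simp_all
    qed
    show "?f ` zball d h (3 * R) \<subseteq> ?P \<times> zball d h R"
    proof
      fix p assume "p \<in> ?f ` zball d h (3 * R)"
      then obtain v where v: "v \<in> zball d h (3 * R)" and p: "p = ?f v" by blast
      have "fst p \<in> ?P" using third_bounds(2) unfolding p by (simp add: restrict_PiE_iff)
      have "3 * L2_set (\<lambda>k. real_of_int (snd p k)) {..<d} =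
            L2_set (\<lambda>k. 3 * real_of_int (snd p k)) {..<d}"
        by (rule L2_set_right_distrib) simp
      also have "\<dots> = L2_set (\<lambda>k. \<bar>3 * real_of_int (third (v k))\<bar>) {..<d}"
        unfolding p L2_set_def by simp
      also have "\<dots> \<le> L2_set (\<lambda>k. \<bar>real_of_int (v k)\<bar>) {..<d}"
      proof (rule L2_set_mono)
        fix k show "\<bar>3 * real_of_int (third (v k))\<bar> \<le> \<bar>real_of_int (v k)\<bar>"
          using third_bounds(1)[of "v k"] by linarith
      qed auto
      also have "\<dots> \<le> 3 * R" using v by (simp add: zball_def L2_set_def)
      finally have "L2_set (\<lambda>k. real_of_int (snd p k)) {..<d} \<le> R"
        by simp
      moreover have "third (v k) \<in> {-h..h}" if "k < d" for k
      proof -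
        have "v k \<in> {-h..h}" using v that unfolding zball_def by blast
        then show ?thesis using third_bounds(1)[of "v k"] unfolding atLeastAtMost_iff by linarith
      qed
      ultimately have "snd p \<in> zball d h R"
        unfolding p zball_def by (simp only: snd_conv mem_Collect_eq restrict_PiE_iff) blast
      then show "p \<in> ?P \<times> zball d h R" using \<open>fst p \<in> ?P\<close> by (simp add: mem_Times_iff)
    qed
    show "finite (?P \<times> zball d h R)"
      by (intro finite_cartesian_product finite_PiE finite_zball) simp_all
  qed
  also have "\<dots> = 5 ^ d * card (zball d h R)"
    by (simp add: card_cartesian_product card_PiE del: restrict_PiE_iff)
  finally show ?thesis .
qed

text \<open>If each of the \<open>m\<close> steps grew by more than the factor \<open>E\<close>, the
  total growth would exceed \<open>E ^ m\<close>.\<close>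

lemma exists_small_ratio:
  fixes f :: "nat \<Rightarrow> real"
  assumes "0 < m" "0 < f 0" "0 \<le> E" "f m \<le> E ^ m * f 0"
  shows "\<exists>i<m. f (Suc i) \<le> E * f i"
proof (rule ccontr)
  assume "\<not> ?thesis"
  then have *: "E * f i < f (Suc i)" if "i < m" for i using that by force
  have "E ^ i * f 0 \<le> f i" if "i \<le> m" for i
    using that
  proof (induction i)
    case (Suc i)
    then have "E * (E ^ i * f 0) \<le> E * f i" using assms by (intro mult_left_mono) auto
    also have "\<dots> < f (Suc i)" using * Suc by simp
    finally show ?case by (simp add: mult.assoc)
  qed simp
  \<comment> \<open>The induction gives only a weak inequality; the last step is split off to make
    it strict.\<close>
  moreover obtain n where n: "m = Suc n" using assms(1) by (cases m) auto
  ultimately have "E * (E ^ n * f 0) \<le> E * f n" using assms by (intro mult_left_mono) auto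
  also have "\<dots> < f m" using * n by simp
  finally show False using assms(4) n by (simp add: mult.assoc)
qed

text \<open>The slack between ln 5 and 33/20 pays for the rounding errors in the radii below.\<close>

lemma five_le_exp: "(5::real) \<le> exp (33/20)"
proof -
  \<comment> \<open>The power \<open>(833/800)^40\<close> already exceeds 5, which is a computation
    with rationals.\<close>
  have "(5::real) \<le> (1 + (33/20) / real 40) ^ 40" by (simp add: power_divide)
  also have "\<dots> \<le> exp (33/20)" by (rule exp_ge_one_plus_x_over_n_power_n) auto
  finally show ?thesis .
qed

text \<open>The largest radius allowed by the diameter bound is
  \<open>R\<^sub>1 = (h - sqrt d) / 2\<close>. Descending from it by \<open>m\<close> steps of
  length \<open>\<Delta>\<close> still leaves at least \<open>R\<^sub>1 / 3\<close>, so the total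
  growth is at most \<open>5^d \<le> E^m\<close> for \<open>E = exp (8 * d / \<Gamma>)\<close>, and
  one of the steps grows by at most \<open>E\<close>.\<close>

lemma exists_radius:
  assumes \<Gamma>: "8 \<le> \<Gamma>" "\<Gamma> \<le> 2 * real d" and h: "h = 1000 * (int d)\<^sup>2"
  defines "\<Delta> \<equiv> real_of_int h / \<Gamma> + sqrt (real d)"
  shows "\<exists>R\<ge>0. 2 * R + sqrt (real d) \<le> h \<and> R + \<Delta> \<le> h \<and>
           real (card (zball d h (R + \<Delta>))) \<le> exp (8 * real d / \<Gamma>) * real (card (zball d h R))"
proof -
  have d: "4 \<le> real d" using \<Gamma> by linarith
  define H where "H = real_of_int h"
  have H: "H = 1000 * (real d)\<^sup>2" by (simp add: H_def h)
  have "(real d)\<^sup>2 \<ge> 1 * real d" unfolding power2_eq_square using d by (intro mult_right_mono) auto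
  then have dd: "real d \<le> (real d)\<^sup>2" by simp
  have sd: "sqrt (real d) \<le> real d"
    using d by (intro real_le_lsqrt) (use dd in auto)
  have s1: "sqrt (real d) \<le> H / 1000" using sd dd unfolding H by linarith
  \<comment> \<open>Here the quadratic size of \<open>h\<close> is used: by
    \<open>\<Gamma> \<le> 2 * d\<close> the rounding term \<open>sqrt d\<close> is small even
    compared with \<open>H / \<Gamma>\<close>.\<close>
  have "sqrt (real d) * \<Gamma> \<le> real d * (2 * real d)"
    using sd \<Gamma> by (intro mult_mono) auto
  then have s2: "sqrt (real d) * \<Gamma> \<le> H / 500" by (simp add: H power2_eq_square)
  have H0: "0 < H" using d H by simp
  have \<Delta>0: "0 < \<Delta>" unfolding \<Delta>_def H_def[symmetric] using H0 \<Gamma> by (intro add_pos_nonneg) auto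
  define R\<^sub>1 where "R\<^sub>1 = (H - sqrt (real d)) / 2"
  \<comment> \<open>The real number of steps of length \<open>\<Delta>\<close> that fit into two
    thirds of \<open>R\<^sub>1\<close>.\<close>
  define y where "y = (H - sqrt (real d)) / (3 * \<Delta>)"
  define m where "m = nat \<lfloor>y\<rfloor>"
  have \<Delta>\<Gamma>: "\<Delta> * \<Gamma> = H + sqrt (real d) * \<Gamma>"
    unfolding \<Delta>_def H_def[symmetric] using \<Gamma> by (simp add: field_simps)
  \<comment> \<open>The growth bound needs \<open>33/160 * \<Gamma>\<close> steps, since
    \<open>8 * 33/160 = 33/20\<close>. The extra \<open>\<Gamma> / 8 \<ge> 1\<close> pays for
    rounding \<open>y\<close> down.\<close>
  have y: "(33/160 + 1/8) * \<Gamma> \<le> y"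
  proof -
    \<comment> \<open>The coefficient on the right is 159/160; the missing 1/160 absorbs the errors
      \<open>H / 500\<close> and \<open>H / 1000\<close>.\<close>
    have "(33/160 + 1/8) * \<Gamma> * (3 * \<Delta>) = (33/160 + 1/8) * 3 * (H + sqrt (real d) * \<Gamma>)"
      unfolding \<Delta>\<Gamma>[symmetric] by simp
    also have "\<dots> \<le> H - sqrt (real d)" using s1 s2 H0 by simp
    finally show ?thesis unfolding y_def using \<Delta>0 by (simp add: pos_le_divide_eq)
  qed
  have m: "33/160 * \<Gamma> \<le> real m" "real m \<le> y"
  proof -
    have "0 \<le> (33/160 + 1/8) * \<Gamma>" using \<Gamma> by simp
    then have "0 \<le> y" using y by linarith
    then have "real m = of_int \<lfloor>y\<rfloor>" by (simp add: m_def)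
    then show "33/160 * \<Gamma> \<le> real m" "real m \<le> y" using y \<Gamma> unfolding distrib_right by linarith+
  qed
  have m0: "0 < m" using m \<Gamma> by (cases m) auto
  have "real m * \<Delta> \<le> y * \<Delta>" using m \<Delta>0 by (intro mult_right_mono) auto
  also have "\<dots> = 2 / 3 * R\<^sub>1" unfolding y_def R\<^sub>1_def using \<Delta>0 by simp
  finally have R0: "R\<^sub>1 \<le> 3 * (R\<^sub>1 - real m * \<Delta>)" by simp
  have R1: "0 \<le> R\<^sub>1" unfolding R\<^sub>1_def using s1 H0 by simp
  define R where "R i = R\<^sub>1 - (real m - real i) * \<Delta>" for i
  define f where "f i = real (card (zball d h (R i)))" for i
  have "(\<lambda>k\<in>{..<d}. 0) \<in> zball d h (R 0)"
    using R0 R1 h by (auto simp: zball_def L2_set_def R_def)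
  then have f0: "0 < f 0" using finite_zball by (auto simp: f_def card_gt_0_iff)
  have "f m \<le> real (card (zball d h (3 * R 0)))"
    unfolding f_def using R0 by (intro of_nat_mono card_mono finite_zball zball_mono) (simp add: R_def)
  also have "\<dots> \<le> real (5 ^ d * card (zball d h (R 0)))"
    by (intro of_nat_mono card_zball_triple)
  also have "\<dots> = 5 ^ d * f 0" by (simp add: f_def)
  also have "\<dots> \<le> exp (33/20) ^ d * f 0"
    using five_le_exp f0 by (intro mult_right_mono power_mono) auto
  also have "exp (33/20) ^ d = exp (real d * (33/20))" by (simp only: exp_of_nat_mult)
  also have "\<dots> \<le> exp (real m * (8 * real d / \<Gamma>))"
  proof -
    have "33/20 \<le> real m * 8 / \<Gamma>" using m \<Gamma> by (simp add: pos_le_divide_eq)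
    then have "real d * (33/20) \<le> real d * (real m * 8 / \<Gamma>)" by (intro mult_left_mono) auto
    then show ?thesis by (simp add: mult_ac)
  qed
  also have "\<dots> = exp (8 * real d / \<Gamma>) ^ m" by (simp only: exp_of_nat_mult)
  finally have "f m \<le> exp (8 * real d / \<Gamma>) ^ m * f 0" using f0 by simp
  then obtain i where i: "i < m" "f (Suc i) \<le> exp (8 * real d / \<Gamma>) * f i"
    using exists_small_ratio[of m f "exp (8 * real d / \<Gamma>)"] m0 f0 by auto
  have suc: "R (Suc i) = R i + \<Delta>" by (simp add: R_def algebra_simps)
  have "R (Suc i) \<le> R\<^sub>1"
    using i(1) \<Delta>0 by (simp add: R_def)
  then have up: "R i + \<Delta> \<le> R\<^sub>1" by (simp only: suc)
  have "R 0 \<le> R i" using \<Delta>0 by (simp add: R_def)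
  moreover have "0 \<le> R 0" using R0 R1 by (simp add: R_def)
  ultimately have low: "0 \<le> R i" by linarith
  have s0: "0 \<le> sqrt (real d)" by simp
  have two: "2 * R\<^sub>1 = H - sqrt (real d)" by (simp add: R\<^sub>1_def)
  show ?thesis
  proof (intro exI[of _ "R i"] conjI low)
    show "2 * R i + sqrt (real d) \<le> h" using up two \<Delta>0 unfolding H_def by linarith
    show "R i + \<Delta> \<le> h" using up two s0 R1 unfolding H_def by linarith
    show "real (card (zball d h (R i + \<Delta>))) \<le> exp (8 * real d / \<Gamma>) * real (card (zball d h (R i)))"
      using i(2) by (simp only: f_def suc)
  qed
qed

text \<open>The squared length of the vector encoded by a residue. It is an integer and can
  therefore be kept in a register.\<close>

definition radix_norm :: "int \<Rightarrow> nat \<Rightarrow> int \<Rightarrow> int" where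
  "radix_norm h d a = (\<Sum>k<d. (bdigit h d a k)\<^sup>2)"

lemma L2_set_bdigit:
  "L2_set (\<lambda>k. real_of_int (bdigit h d a k)) {..<d} = sqrt (of_int (radix_norm h d a))"
  by (simp add: L2_set_def radix_norm_def)

text \<open>Balanced digits are a bijection between residues and vectors in the box, and they carry
  \<open>radix_norm\<close> to the squared length.\<close>

lemma card_radix_ball:
  assumes h: "0 \<le> h"
  shows "card {a \<in> {0..<(2*h+1)^d}. sqrt (of_int (radix_norm h d a)) \<le> R} = card (zball d h R)"
proof (rule bij_betw_same_card)
  let ?f = "\<lambda>a. restrict (bdigit h d a) {..<d}"
  let ?g = "\<lambda>v. (\<Sum>k<d. v k * (2*h+1)^k) mod (2*h+1)^d"
  have L2: "L2_set (\<lambda>k. real_of_int (restrict v {..<d} k)) {..<d} = L2_set (\<lambda>k. real_of_int (v k)) {..<d}"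
    for v by (auto simp: L2_set_def)
  have fg: "restrict (bdigit h d (?g v)) {..<d} = v" if "v \<in> zball d h R" for v
  proof (rule extensionalityI[of _ "{..<d}"])
    fix k assume "k \<in> {..<d}"
    moreover have "\<bar>v k\<bar> \<le> h" if "k < d" for k
      using \<open>v \<in> zball d h R\<close> that by (force simp: zball_def abs_le_iff PiE_iff)
    ultimately show "restrict (bdigit h d (?g v)) {..<d} k = v k"
      using bdigit_unique[of d v h "?g v" k] by simp
  qed (use that in \<open>auto simp: zball_def PiE_def\<close>)
  show "bij_betw ?f {a \<in> {0..<(2*h+1)^d}. sqrt (of_int (radix_norm h d a)) \<le> R} (zball d h R)"
  proof (rule bij_betw_byWitness[where f' = ?g])
    show "\<forall>a\<in>{a \<in> {0..<(2*h+1)^d}. sqrt (of_int (radix_norm h d a)) \<le> R}. ?g (?f a) = a"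
      using sum_bdigit[OF h, of d] by simp
    show "\<forall>v\<in>zball d h R. ?f (?g v) = v" using fg by blast
    show "?f ` {a \<in> {0..<(2*h+1)^d}. sqrt (of_int (radix_norm h d a)) \<le> R} \<subseteq> zball d h R"
    proof
      fix v assume "v \<in> ?f ` {a \<in> {0..<(2*h+1)^d}. sqrt (of_int (radix_norm h d a)) \<le> R}"
      then obtain a where "sqrt (of_int (radix_norm h d a)) \<le> R" and v: "v = ?f a" by blast
      then have "L2_set (\<lambda>k. real_of_int (v k)) {..<d} \<le> R"
        unfolding v L2 L2_set_bdigit by blast
      moreover have "bdigit h d a k \<in> {-h..h}" for k
        using bdigit_bounds[OF h, of d a k] by (simp add: abs_le_iff minus_le_iff)
      ultimately show "v \<in> zball d h R"
        unfolding zball_def v by (simp only: mem_Collect_eq restrict_PiE_iff) blast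
    qed
    show "?g ` zball d h R \<subseteq> {a \<in> {0..<(2*h+1)^d}. sqrt (of_int (radix_norm h d a)) \<le> R}"
    proof safe
      fix v assume v: "v \<in> zball d h R"
      show "?g v \<in> {0..<(2*h+1)^d}" using h by simp
      have "L2_set (\<lambda>k. real_of_int (bdigit h d (?g v) k)) {..<d} = L2_set (\<lambda>k. real_of_int (v k)) {..<d}"
        using fg[OF v] L2 by metis
      then show "sqrt (of_int (radix_norm h d (?g v))) \<le> R"
        using v by (simp add: zball_def L2_set_bdigit)
    qed
  qed
qed

section \<open>Weakest preconditions for bounded registers\<close>

definition fits :: "nat set \<Rightarrow> int \<Rightarrow> store \<Rightarrow> bool" where
  "fits V L s \<longleftrightarrow> (\<forall>v\<in>V. \<bar>s v\<bar> \<le> L)"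

text \<open>Each variable is charged a sign bit and the digits of the bound \<open>L\<close>. The
  space bound thereby reduces to a bound on magnitudes.\<close>

definition capacity :: "nat set \<Rightarrow> int \<Rightarrow> nat" where
  "capacity V L = card V * (floorlog 2 (nat L) + 1)"

text \<open>A total-correctness precondition which also asserts the space bound.\<close>

definition wp :: "(nat \<Rightarrow> real) \<Rightarrow> nat set \<Rightarrow> int \<Rightarrow> com \<Rightarrow> (store \<Rightarrow> (nat \<Rightarrow> real) \<Rightarrow> bool)
    \<Rightarrow> store \<Rightarrow> (nat \<Rightarrow> real) \<Rightarrow> bool" where
  "wp inp V L c Q s out \<longleftrightarrow>
     (\<exists>s' out' m. exec inp V c s out s' out' m \<and> m \<le> capacity V L \<and> Q s' out')"

lemma store_bits_le: "fits V L s \<Longrightarrow> store_bits V s \<le> capacity V L"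
  unfolding store_bits_def capacity_def int_bits_def fits_def
  by (rule sum_bounded_above[where 'a = nat, simplified]) (simp add: floorlog_mono nat_mono)

lemma fits_upd: "fits V L s \<Longrightarrow> \<bar>e\<bar> \<le> L \<Longrightarrow> fits V L (s(v := e))"
  by (simp add: fits_def)

lemma wp_assign:
  assumes "fits V L s" "\<lfloor>eval_expr inp s a\<rfloor> = e" "\<bar>e\<bar> \<le> L"
    "fits V L (s(v := e)) \<Longrightarrow> Q (s(v := e)) out"
  shows "wp inp V L (Assign v a) Q s out"
proof -
  have fits': "fits V L (s(v := e))" by (rule fits_upd[OF assms(1,3)])
  have "exec inp V (Assign v a) s out (s(v := e)) out (max (store_bits V s) (store_bits V (s(v := e))))"
    by (rule exec_Assign) (simp add: assms(2))
  moreover have "max (store_bits V s) (store_bits V (s(v := e))) \<le> capacity V L"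
    using store_bits_le[OF assms(1)] store_bits_le[OF fits'] by simp
  ultimately show ?thesis unfolding wp_def using assms(4)[OF fits'] by blast
qed

lemma wp_output:
  assumes "fits V L s" "Q s (out(nat \<lfloor>eval_expr inp s a\<rfloor> := eval_expr inp s b))"
  shows "wp inp V L (Output a b) Q s out"
  unfolding wp_def using assms(2) store_bits_le[OF assms(1)] exec_Output[OF refl] by blast

lemma wp_seq: "wp inp V L c (wp inp V L c' Q) s out \<Longrightarrow> wp inp V L (Seq c c') Q s out"
  unfolding wp_def by (metis exec_Seq max.boundedI)

lemma wp_cond:
  assumes "eval_expr inp s a < eval_expr inp s b \<Longrightarrow> wp inp V L c Q s out"
    "\<not> eval_expr inp s a < eval_expr inp s b \<Longrightarrow> wp inp V L c' Q s out"
  shows "wp inp V L (Cond a b c c') Q s out"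
  using assms unfolding wp_def by (metis exec_Cond_True exec_Cond_False)

text \<open>Induction on the variant. The invariant must imply \<open>fits\<close> because leaving
  the loop is charged with the bits of the current store.\<close>

lemma wp_loop:
  fixes \<mu> :: "store \<Rightarrow> nat"
  assumes "I s out"
    and step: "\<And>s out. I s out \<Longrightarrow> eval_expr inp s a < eval_expr inp s b \<Longrightarrow>
          wp inp V L c (\<lambda>s' out'. I s' out' \<and> \<mu> s' < \<mu> s) s out"
    and exit: "\<And>s out. I s out \<Longrightarrow> \<not> eval_expr inp s a < eval_expr inp s b \<Longrightarrow> Q s out"
    and fits: "\<And>s out. I s out \<Longrightarrow> fits V L s"
  shows "wp inp V L (Loop a b c) Q s out"
  using assms(1)
proof (induction "\<mu> s" arbitrary: s out rule: less_induct)
  case less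
  show ?case
  proof (cases "eval_expr inp s a < eval_expr inp s b")
    case True
    then obtain s' out' m where 1: "exec inp V c s out s' out' m" "m \<le> capacity V L"
      "I s' out'" "\<mu> s' < \<mu> s"
      using step[OF less.prems] by (auto simp: wp_def)
    then obtain s'' out'' m' where "exec inp V (Loop a b c) s' out' s'' out'' m'"
      "m' \<le> capacity V L" "Q s'' out''"
      using less.hyps[OF 1(4,3)] unfolding wp_def by blast
    then have "exec inp V (Loop a b c) s out s'' out'' (max m m')" "max m m' \<le> capacity V L" "Q s'' out''"
      using exec_Loop_True[OF True 1(1)] 1(2) by auto
    then show ?thesis unfolding wp_def by blast
  next
    case False
    then show ?thesis
      using exec_Loop_False[OF False] exit[OF less.prems False] store_bits_le[OF fits[OF less.prems]]
      unfolding wp_def by blast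
  qed
qed

section \<open>Packing a list of numbers into one integer\<close>

text \<open>Base-\<open>X\<close> digits, the first one least significant, with a leading 1. The
  leading 1 makes the value at least \<open>X ^ length zs\<close>, hence larger than all indices of
  subset sums.\<close>

primrec enc :: "int \<Rightarrow> int list \<Rightarrow> int" where
  "enc X [] = 1"
| "enc X (z # zs) = z + X * enc X zs"

lemma enc_pos: "0 < X \<Longrightarrow> set zs \<subseteq> {0..<X} \<Longrightarrow> 0 < enc X zs"
  by (induction zs) (auto intro: add_nonneg_pos)

lemma power_le_enc: "0 < X \<Longrightarrow> set zs \<subseteq> {0..<X} \<Longrightarrow> X ^ length zs \<le> enc X zs"
proof (induction zs)
  case (Cons z zs)
  then have "X * X ^ length zs \<le> X * enc X zs" "0 \<le> z" by simp_all
  then show ?case unfolding enc.simps list.size power_Suc by simp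
qed simp

lemma enc_less: "1 < X \<Longrightarrow> set zs \<subseteq> {0..<X} \<Longrightarrow> enc X zs < 2 * X ^ length zs"
proof (induction zs)
  case (Cons z zs)
  then have "X * (enc X zs + 1) \<le> X * (2 * X ^ length zs)" by simp
  then show ?case using Cons.prems by (auto simp: algebra_simps)
qed simp

text \<open>Every generator is a digit of the packed number, which dominates the sum of its digits.
  This bounds the unreduced subset sums in the program.\<close>

lemma shift_nonneg_le_enc:
  "0 < X \<Longrightarrow> set zs \<subseteq> {0..<X} \<Longrightarrow> 0 \<le> shift zs j \<and> shift zs j \<le> enc X zs"
proof (induction zs arbitrary: j)
  case (Cons z zs)
  then have IH: "0 \<le> shift zs (j div 2)" "shift zs (j div 2) \<le> enc X zs" and z: "0 \<le> z" by auto
  have "1 * enc X zs \<le> X * enc X zs"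
    using Cons.prems enc_pos[of X zs] by (intro mult_right_mono) auto
  moreover have "0 \<le> int (j mod 2) * z" "int (j mod 2) * z \<le> z"
    using z by (cases "even j"; simp add: mod2_eq_if)+
  ultimately show ?case using IH by simp
qed simp

section \<open>The evaluation program\<close>

abbreviation div_expr :: "expr \<Rightarrow> expr \<Rightarrow> expr" where
  "div_expr a b \<equiv> Floor (Quot a b)"

abbreviation mod_expr :: "expr \<Rightarrow> expr \<Rightarrow> expr" where
  "mod_expr a b \<equiv> Sub a (Mul b (div_expr a b))"

definition "half_expr = Mul (Const 1000) (Mul (Var 0) (Var 0))"
definition "radix_expr = Add (Mul (Const 2) half_expr) (Const 1)"

text \<open>Numbers are packed in base Q^6, which exceeds both the block size and the squared radii.\<close>
definition "base_expr = Mul (Mul (Mul (Var 3) (Var 3)) (Mul (Var 3) (Var 3))) (Mul (Var 3) (Var 3))"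
definition "grid_expr = Floor (Quot (Mul (Input (Add (Var 2) (Const 2))) half_expr) (Input (Const 0)))"

text \<open>
  Registers: 0 holds d, 1 the unread part of the description, 2 a coordinate, 3 the modulus Q, 4 the
  residue of the input, 5 and 6 the squared radii r and r', 7 the number S of translates per block,
  8 the current index j, 9 and 10 the unread bits of j and the unread generators, 11 the residue
  relative to the centre, 12 its unread digits, and 13 the squared norm.
  When j touches the outer ball but misses the inner one, the search jumps to the next block.
\<close>

definition power_prog :: com where
  "power_prog = Loop (Var 2) (Var 0)
     (Seq (Assign 3 (Mul (Var 3) radix_expr))
          (Assign 2 (Add (Var 2) (Const 1))))"

definition grid_prog :: com where
  "grid_prog = Loop (Const 0) (Var 2)
     (Seq (Assign 2 (Sub (Var 2) (Const 1)))
          (Assign 4 (mod_expr (Add (Mul (Var 4) radix_expr) grid_expr) (Var 3))))"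

definition load_prog :: "nat \<Rightarrow> com" where
  "load_prog v = Seq (Assign v (mod_expr (Var 1) base_expr)) (Assign 1 (div_expr (Var 1) base_expr))"

definition shift_prog :: com where
  "shift_prog = Loop (Const 0) (Var 9)
     (Seq (Assign 11 (Sub (Var 11) (Mul (mod_expr (Var 9) (Const 2)) (mod_expr (Var 10) base_expr))))
     (Seq (Assign 10 (div_expr (Var 10) base_expr))
          (Assign 9 (div_expr (Var 9) (Const 2)))))"

abbreviation "digit_expr v \<equiv> Sub (mod_expr (Var v) radix_expr) half_expr"

definition norm_prog :: com where
  "norm_prog = Loop (Var 2) (Var 0)
     (Seq (Assign 13 (Add (Var 13) (Mul (digit_expr 12) (digit_expr 12))))
     (Seq (Assign 12 (div_expr (Var 12) radix_expr))
          (Assign 2 (Add (Var 2) (Const 1)))))"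

text \<open>The self-assignment in the last branch is a no-op: after a hit the index stays in
  place.\<close>

definition advance_prog :: com where
  "advance_prog = Cond (Var 5) (Var 13)
     (Cond (Var 6) (Var 13)
        (Assign 8 (Add (Var 8) (Const 1)))
        (Assign 8 (Mul (Add (div_expr (Var 8) (Var 7)) (Const 1)) (Var 7))))
     (Assign 8 (Var 8))"

definition search_prog :: com where
  "search_prog = Loop (Var 5) (Var 13)
     (Seq (Assign 9 (Var 8))
     (Seq (Assign 10 (Var 1))
     (Seq (Assign 11 (Var 4))
     (Seq shift_prog
     (Seq (Assign 11 (mod_expr (Add (Var 11) (div_expr (Sub (Var 3) (Const 1)) (Const 2))) (Var 3)))
     (Seq (Assign 12 (Var 11))
     (Seq (Assign 13 (Const 0))
     (Seq (Assign 2 (Const 0))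
     (Seq norm_prog
          advance_prog)))))))))"

definition output_prog :: com where
  "output_prog = Loop (Var 2) (Var 0)
     (Seq (Output (Var 2) (Add (Sub grid_expr (digit_expr 11))
                               (Quot (Const 1) (Add (Var 8) (Const 2)))))
     (Seq (Assign 11 (div_expr (Var 11) radix_expr))
          (Assign 2 (Add (Var 2) (Const 1)))))"

definition hash_prog :: com where
  "hash_prog =
     Seq (Assign 3 (Const 1))
     (Seq power_prog
     (Seq grid_prog
     (Seq (load_prog 5)
     (Seq (load_prog 6)
     (Seq (load_prog 7)
     (Seq (Assign 13 (Add (Var 5) (Const 1)))
     (Seq search_prog
     (Seq (Assign 2 (Const 0))
          output_prog))))))))"

text \<open>Pulls \<open>of_int\<close> outwards through an expression, so that the floor of a real
  quotient becomes \<open>div\<close> and the derived remainder becomes \<open>mod\<close>.\<close>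

lemmas int_eval = eval_expr.simps of_int_add[symmetric] of_int_diff[symmetric]
  of_int_mult[symmetric] floor_divide_of_int_eq floor_of_int minus_mult_div_eq_mod of_int_less_iff

lemmas store_simps = fun_upd_apply rel_simps simp_thms if_True if_False

section \<open>Correctness of the program, phase by phase\<close>

locale hash_params =
  fixes d :: nat and h M Q X :: int
  assumes d: "4 \<le> d"
    and h: "h = 1000 * (int d * int d)" and M: "M = 2 * h + 1" and Q: "Q = M ^ d"
    and X: "X = Q * Q * (Q * Q) * (Q * Q)"
begin

lemma h_ge: "16000 \<le> h" "int d \<le> h"
proof -
  have "4 * int d \<le> int d * int d" using d by (intro mult_right_mono) auto
  then show "16000 \<le> h" "int d \<le> h" using h d by linarith+
qed

lemma M_gt: "32000 < M" "int d \<le> M" using h_ge M by linarith+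

lemma Q_gt: "M ^ 4 \<le> Q" "32000 < Q" "0 < Q"
proof -
  show 1: "M ^ 4 \<le> Q" unfolding Q using M_gt d by (intro power_increasing) auto
  have "M ^ 1 \<le> M ^ 4" using M_gt by (intro power_increasing) auto
  then show "32000 < Q" using 1 M_gt by simp
  then show "0 < Q" by simp
qed

lemma X_ge: "Q \<le> X" "0 < X" "2 < X"
proof -
  have 1: "1 * 1 \<le> Q * Q" using Q_gt by (intro mult_mono) auto
  then have "1 * 1 \<le> (Q * Q) * (Q * Q)" by (intro mult_mono) auto
  then have "1 * (Q * Q) \<le> Q * Q * (Q * Q) * (Q * Q)"
    using 1 by (intro mult_right_mono) auto
  moreover have "1 * Q \<le> Q * Q" using Q_gt by (intro mult_right_mono) auto
  ultimately show "Q \<le> X" unfolding X by simp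
  then show "0 < X" "2 < X" using Q_gt by linarith+
qed

end

text \<open>One input point and one description. That some index wins is assumed only in
  \<open>hash_search\<close>.\<close>

locale hash_scan = hash_params +
  fixes l \<Gamma> :: real and x :: "nat \<Rightarrow> real" and r r' :: int and S :: nat and zs :: "int list"
  assumes r: "0 \<le> r" "r \<le> r'" "r' < X" and S: "0 < S" "int S < X" and zs: "set zs \<subseteq> {0..<X}"
begin

definition "inp = real_input l \<Gamma> x"
definition "g k = \<lfloor>x k * of_int h / l\<rfloor>"
definition "y = (\<Sum>k<d. g k * M ^ k) mod Q"
definition "W = enc X zs"
text \<open>The description itself, as an integer, bounds every register during the whole run. So
  the space is proportional to the description length.\<close>

definition "L = enc X (r # r' # int S # zs)"

lemma W_pos: "1 \<le> W"
  using enc_pos[OF X_ge(2) zs] by (simp add: W_def)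

lemma L_eq: "L = r + X * (r' + X * (int S + X * W))"
  by (simp add: L_def W_def)

lemma parts_le: "X * W \<le> int S + X * W" "int S + X * W \<le> r' + X * (int S + X * W)"
  "r' + X * (int S + X * W) \<le> L"
proof -
  have "1 * a \<le> X * a" if "0 \<le> a" for a
    using X_ge that by (intro mult_right_mono) auto
  then have le: "0 \<le> a \<Longrightarrow> a \<le> X * a" for a by simp
  have 0: "0 \<le> X * W" using X_ge W_pos by simp
  show 1: "X * W \<le> int S + X * W" by simp
  show 2: "int S + X * W \<le> r' + X * (int S + X * W)"
    using le[of "int S + X * W"] 0 r by simp
  show "r' + X * (int S + X * W) \<le> L"
    using le[of "r' + X * (int S + X * W)"] 0 1 2 r unfolding L_eq by linarith
qed

lemma two_W_le: "W + X \<le> X * W + 1"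
proof -
  have "0 \<le> (X - 1) * (W - 1)" using X_ge W_pos by (intro mult_nonneg_nonneg) auto
  then show ?thesis by (simp add: algebra_simps)
qed

text \<open>The magnitudes that occur: unreduced residues up to \<open>W + Q\<close>, squared norms
  up to \<open>d * h^2\<close>, and indices below \<open>2 ^ length zs\<close>.\<close>

lemma L_bounds: "X < L" "W < L" "W + Q \<le> L" "int d \<le> L" "Q \<le> L" "int d * (h * h) \<le> L" "2 ^ length zs \<le> L"
proof -
  have XL: "X * W + 1 \<le> L" using parts_le S by linarith
  then show WX: "W + Q \<le> L" using two_W_le X_ge by linarith
  show "X < L" using XL two_W_le W_pos X_ge Q_gt S parts_le by linarith
  show "W < L" using WX Q_gt by linarith
  show QL: "Q \<le> L" using WX W_pos by linarith
  have "M * 1 \<le> M * M ^ 3" using M_gt by (intro mult_left_mono one_le_power) auto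
  then have "M \<le> Q" using Q_gt(1) by (simp add: eval_nat_numeral)
  then show "int d \<le> L" using M_gt QL by linarith
  have "int d * (h * h) \<le> M * (M * M)"
    using M_gt M h_ge by (intro mult_mono) auto
  also have "\<dots> \<le> M ^ 4"
    using power_increasing[of 3 4 M] M_gt by (simp add: eval_nat_numeral mult.assoc)
  finally show "int d * (h * h) \<le> L" using Q_gt QL by linarith
  have "(2::int) ^ length zs \<le> X ^ length zs" using X_ge by (intro power_mono) auto
  also have "\<dots> \<le> W" unfolding W_def by (rule power_le_enc[OF X_ge(2) zs])
  finally show "2 ^ length zs \<le> L" using \<open>W < L\<close> by linarith
qed

lemma half_eval: "s 0 = int d \<Longrightarrow> eval_expr i s half_expr = of_int h"
  by (simp add: half_expr_def h)

lemma radix_eval: "s 0 = int d \<Longrightarrow> eval_expr i s radix_expr = of_int M"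
  by (simp add: radix_expr_def half_eval M)

lemma base_eval: "s 3 = Q \<Longrightarrow> eval_expr i s base_expr = of_int X"
  by (simp add: base_expr_def X)

lemma grid_eval:
  assumes "s 0 = int d" "s 2 = int k"
  shows "eval_expr inp s grid_expr = of_int (g k)"
proof -
  \<comment> \<open>The inputs at positions 0 and 1 are \<open>l\<close> and
    \<open>\<Gamma>\<close>, so coordinate \<open>k\<close> is at position
    \<open>k + 2\<close>.\<close>
  have "nat \<lfloor>real k + 2\<rfloor> = Suc (Suc k)" by linarith
  then show ?thesis
    using assms by (simp add: grid_expr_def half_eval g_def inp_def real_input_def)
qed

lemmas prog_eval = half_eval radix_eval base_eval grid_eval

lemma wp_power:
  assumes fits: "fits V L s" and s: "s 0 = int d" "s 2 = 0" "s 3 = 1"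
    and post: "fits V L (s(2 := int d, 3 := Q)) \<Longrightarrow> P (s(2 := int d, 3 := Q)) out"
  shows "wp inp V L power_prog P s out"
  unfolding power_prog_def
proof (rule wp_loop[where I = "\<lambda>s' out'. out' = out \<and> fits V L s' \<and>
      (\<exists>k\<le>d. s' = s(2 := int k, 3 := M^k))" and \<mu> = "\<lambda>s. d - nat (s 2)"])
  have "s = s(2 := int 0, 3 := M ^ 0)" using s by (simp add: fun_eq_iff)
  then show "out = out \<and> fits V L s \<and> (\<exists>k\<le>d. s = s(2 := int k, 3 := M ^ k))"
    using fits by blast
next
  fix s' out'
  assume I: "out' = out \<and> fits V L s' \<and> (\<exists>k\<le>d. s' = s(2 := int k, 3 := M ^ k))"
    and "eval_expr inp s' (Var 2) < eval_expr inp s' (Var 0)"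
  then obtain k where s': "s' = s(2 := int k, 3 := M ^ k)" and k: "k < d" using s(1) by auto
  have "M ^ Suc k \<le> Q" unfolding Q using M_gt k by (intro power_increasing) auto
  then have p: "0 \<le> M ^ Suc k" "M ^ Suc k \<le> L" using M_gt L_bounds by auto
  have e1: "\<lfloor>eval_expr inp s' (Mul (Var 3) radix_expr)\<rfloor> = M ^ Suc k"
    using s unfolding s' by (simp only: int_eval prog_eval store_simps power_Suc mult.commute)
  show "wp inp V L (Seq (Assign 3 (Mul (Var 3) radix_expr)) (Assign 2 (Add (Var 2) (Const 1))))
     (\<lambda>s'' out''. (out'' = out \<and> fits V L s'' \<and> (\<exists>k\<le>d. s'' = s(2 := int k, 3 := M ^ k))) \<and>
        d - nat (s'' 2) < d - nat (s' 2)) s' out'"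
    apply (intro wp_seq wp_assign[OF _ e1])
    subgoal using I by blast
    subgoal using p by simp
    apply (rule wp_assign[where e = "int (Suc k)"])
    subgoal .
    subgoal by (simp add: s')
    subgoal using k L_bounds by simp
    subgoal using I k by (auto simp: s' fun_eq_iff intro!: exI[of _ "Suc k"])
    done
next
  fix s' out'
  assume I: "out' = out \<and> fits V L s' \<and> (\<exists>k\<le>d. s' = s(2 := int k, 3 := M ^ k))"
    and "\<not> eval_expr inp s' (Var 2) < eval_expr inp s' (Var 0)"
  then have "s' = s(2 := int d, 3 := Q)" using s(1) unfolding Q by auto
  then show "P s' out'" using post I by auto
qed auto

text \<open>The state of Horner's scheme after the coordinates from \<open>d - 1\<close> down to
  \<open>k\<close>.\<close>

definition "horner k = (\<Sum>i<d - k. g (k + i) * M ^ i) mod Q"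

lemma horner_Suc: "k < d \<Longrightarrow> (horner (Suc k) * M + g k) mod Q = horner k"
proof -
  assume "k < d"
  then have "d - k = Suc (d - Suc k)" by simp
  then have "(\<Sum>i<d - k. g (k + i) * M ^ i) = (\<Sum>i<d - Suc k. g (Suc k + i) * M ^ i) * M + g k"
    by (simp add: sum.lessThan_Suc_shift sum_distrib_left mult_ac del: sum.lessThan_Suc)
  then show ?thesis unfolding horner_def by (simp only: mod_add_cong[OF mod_mult_left_eq refl])
qed

lemma horner_bounds: "0 \<le> horner k" "horner k < Q"
  using Q_gt by (auto simp: horner_def)

lemma wp_grid:
  assumes fits: "fits V L s" and s: "s 0 = int d" "s 2 = int d" "s 3 = Q" "s 4 = 0"
    and post: "fits V L (s(2 := 0, 4 := y)) \<Longrightarrow> P (s(2 := 0, 4 := y)) out"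
  shows "wp inp V L grid_prog P s out"
  unfolding grid_prog_def
proof (rule wp_loop[where I = "\<lambda>s' out'. out' = out \<and> fits V L s' \<and>
      (\<exists>k\<le>d. s' = s(2 := int k, 4 := horner k))" and \<mu> = "\<lambda>s. nat (s 2)"])
  have "s = s(2 := int d, 4 := horner d)" using s by (simp add: fun_eq_iff horner_def)
  then show "out = out \<and> fits V L s \<and> (\<exists>k\<le>d. s = s(2 := int k, 4 := horner k))"
    using fits by blast
next
  fix s' out'
  assume I: "out' = out \<and> fits V L s' \<and> (\<exists>k\<le>d. s' = s(2 := int k, 4 := horner k))"
    and "eval_expr inp s' (Const 0) < eval_expr inp s' (Var 2)"
  then obtain k where s': "s' = s(2 := int k, 4 := horner k)" and k: "k \<le> d" "0 < k" by auto
  then obtain i where i: "k = Suc i" by (cases k) auto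
  have e1: "\<lfloor>eval_expr inp s' (Sub (Var 2) (Const 1))\<rfloor> = int i"
    by (simp add: s' i)
  have e2: "\<lfloor>eval_expr inp (s'(2 := int i)) (mod_expr (Add (Mul (Var 4) radix_expr) grid_expr) (Var 3))\<rfloor> = horner i"
    using s k horner_Suc[of i] unfolding s' i by (simp only: int_eval prog_eval store_simps)
  show "wp inp V L (Seq (Assign 2 (Sub (Var 2) (Const 1)))
          (Assign 4 (mod_expr (Add (Mul (Var 4) radix_expr) grid_expr) (Var 3))))
     (\<lambda>s'' out''. (out'' = out \<and> fits V L s'' \<and> (\<exists>k\<le>d. s'' = s(2 := int k, 4 := horner k))) \<and>
        nat (s'' 2) < nat (s' 2)) s' out'"
    apply (intro wp_seq wp_assign[OF _ e1])
    subgoal using I by blast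
    subgoal using k i L_bounds by simp
    apply (rule wp_assign[OF _ e2])
    subgoal .
    subgoal using horner_bounds[of i] L_bounds by simp
    subgoal using I k i by (auto simp: s' fun_eq_iff intro!: exI[of _ i])
    done
next
  fix s' out'
  assume I: "out' = out \<and> fits V L s' \<and> (\<exists>k\<le>d. s' = s(2 := int k, 4 := horner k))"
    and "\<not> eval_expr inp s' (Const 0) < eval_expr inp s' (Var 2)"
  then have "s' = s(2 := 0, 4 := y)" unfolding y_def by (auto simp: horner_def)
  then show "P s' out'" using post I by auto
qed auto

lemma wp_load:
  assumes fits: "fits V L s" and s: "s 3 = Q" "s 1 = z + X * w" "v \<notin> {1, 3}"
    and z: "0 \<le> z" "z < X" and w: "0 \<le> w" "w \<le> L"
    and post: "fits V L (s(v := z, 1 := w)) \<Longrightarrow> P (s(v := z, 1 := w)) out"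
  shows "wp inp V L (load_prog v) P s out"
proof -
  have e1: "\<lfloor>eval_expr inp s (mod_expr (Var 1) base_expr)\<rfloor> = z"
    using s z by (simp only: int_eval prog_eval) simp
  have e2: "\<lfloor>eval_expr inp (s(v := z)) (div_expr (Var 1) base_expr)\<rfloor> = w"
    using s z by (simp add: base_eval floor_divide_of_int_eq del: of_int_add of_int_mult)
  show ?thesis
    unfolding load_prog_def
    apply (intro wp_seq wp_assign[OF fits e1])
    subgoal using z L_bounds by simp
    apply (rule wp_assign[OF _ e2])
    subgoal .
    subgoal using w by simp
    subgoal by (rule post)
    done
qed


text \<open>The invariant adds back the part of the subset sum that is still to be subtracted, given
  by the unread generators \<open>ws\<close> and the unread bits \<open>i\<close>. The loop stops at
  \<open>i = 0\<close>, possibly with generators left, where this part is 0.\<close>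

lemma wp_shift:
  assumes fits: "fits V L s" and s: "s 3 = Q" "s 9 = int j" "s 10 = W" "s 11 = y"
    and j: "j < 2 ^ length zs"
    and post: "\<And>s'. fits V L s' \<Longrightarrow> (\<And>v. v \<notin> {9, 10, 11} \<Longrightarrow> s' v = s v) \<Longrightarrow>
                 s' 11 = y - shift zs j \<Longrightarrow> P s' out"
  shows "wp inp V L shift_prog P s out"
  unfolding shift_prog_def
proof (rule wp_loop[where I = "\<lambda>s' out'. out' = out \<and> fits V L s' \<and> (\<forall>v. v \<notin> {9, 10, 11} \<longrightarrow> s' v = s v) \<and>
      (\<exists>ws i. set ws \<subseteq> {0..<X} \<and> i < 2 ^ length ws \<and> enc X ws \<le> W \<and> i \<le> j \<and>
         s' 9 = int i \<and> s' 10 = enc X ws \<and> s' 11 = y - shift zs j + shift ws i)"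
      and \<mu> = "\<lambda>s. nat (s 9)"])
  show "out = out \<and> fits V L s \<and> (\<forall>v. v \<notin> {9, 10, 11} \<longrightarrow> s v = s v) \<and>
      (\<exists>ws i. set ws \<subseteq> {0..<X} \<and> i < 2 ^ length ws \<and> enc X ws \<le> W \<and> i \<le> j \<and>
         s 9 = int i \<and> s 10 = enc X ws \<and> s 11 = y - shift zs j + shift ws i)"
    using fits zs j s by (auto simp: W_def intro!: exI[of _ zs] exI[of _ j])
next
  fix s' out'
  assume I: "out' = out \<and> fits V L s' \<and> (\<forall>v. v \<notin> {9, 10, 11} \<longrightarrow> s' v = s v) \<and>
      (\<exists>ws i. set ws \<subseteq> {0..<X} \<and> i < 2 ^ length ws \<and> enc X ws \<le> W \<and> i \<le> j \<and>
         s' 9 = int i \<and> s' 10 = enc X ws \<and> s' 11 = y - shift zs j + shift ws i)"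
    and "eval_expr inp s' (Const 0) < eval_expr inp s' (Var 9)"
  then obtain ws0 i where ws0: "set ws0 \<subseteq> {0..<X}" "i < 2 ^ length ws0" "enc X ws0 \<le> W"
    "s' 9 = int i" "s' 10 = enc X ws0" "s' 11 = y - shift zs j + shift ws0 i" and i: "0 < i" "i \<le> j" by auto
  \<comment> \<open>A generator is left, since \<open>0 < i < 2 ^ length ws0\<close>.\<close>
  obtain z ws where ws: "ws0 = z # ws" using ws0 i by (cases ws0) auto
  have z: "0 \<le> z" "z < X" and wsX: "set ws \<subseteq> {0..<X}" using ws0 ws by auto
  have "1 * enc X ws \<le> X * enc X ws"
    using enc_pos[OF X_ge(2) wsX] X_ge by (intro mult_right_mono) auto
  then have encW: "enc X ws \<le> W" "0 < enc X ws"
    using ws0(3) z enc_pos[OF X_ge(2) wsX] unfolding ws enc.simps by linarith+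
  let ?u = "y - shift zs j + shift ws (i div 2)"
  have "0 \<le> y" "y < Q" using Q_gt by (auto simp: y_def)
  \<comment> \<open>This register is not reduced modulo \<open>Q\<close> inside the loop, which is
    why \<open>W + Q \<le> L\<close> is needed.\<close>
  then have u: "\<bar>?u\<bar> \<le> L"
    using shift_nonneg_le_enc[OF X_ge(2) zs, of j] shift_nonneg_le_enc[OF X_ge(2) wsX, of "i div 2"]
      encW L_bounds unfolding W_def by linarith
  have s3: "s' 3 = Q" using I s by simp
  have mod: "enc X ws0 mod X = z" "enc X ws0 div X = enc X ws" using z ws by auto
  have e1: "\<lfloor>eval_expr inp s' (Sub (Var 11) (Mul (mod_expr (Var 9) (Const 2)) (mod_expr (Var 10) base_expr)))\<rfloor> = ?u"
    using ws0(4-6) ws s3 by (simp only: int_eval prog_eval mod) (simp add: zmod_int z)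
  have e2: "\<lfloor>eval_expr inp (s'(11 := ?u)) (div_expr (Var 10) base_expr)\<rfloor> = enc X ws"
    using ws0(4-6) s3 by (simp only: int_eval prog_eval store_simps mod)
  have e3: "\<lfloor>eval_expr inp (s'(11 := ?u, 10 := enc X ws)) (div_expr (Var 9) (Const 2))\<rfloor> = int (i div 2)"
    using ws0(4-6) by (simp only: int_eval store_simps zdiv_int) simp
  have "int j < 2 ^ length zs" using j by (metis of_nat_less_iff of_nat_numeral of_nat_power)
  then have iL: "\<bar>int (i div 2)\<bar> \<le> L" using i(2) L_bounds by linarith
  show "wp inp V L (Seq (Assign 11 (Sub (Var 11) (Mul (mod_expr (Var 9) (Const 2)) (mod_expr (Var 10) base_expr))))
     (Seq (Assign 10 (div_expr (Var 10) base_expr))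
          (Assign 9 (div_expr (Var 9) (Const 2)))))
     (\<lambda>s'' out''. (out'' = out \<and> fits V L s'' \<and> (\<forall>v. v \<notin> {9, 10, 11} \<longrightarrow> s'' v = s v) \<and>
      (\<exists>ws i. set ws \<subseteq> {0..<X} \<and> i < 2 ^ length ws \<and> enc X ws \<le> W \<and> i \<le> j \<and>
         s'' 9 = int i \<and> s'' 10 = enc X ws \<and> s'' 11 = y - shift zs j + shift ws i)) \<and>
        nat (s'' 9) < nat (s' 9)) s' out'"
    apply (intro wp_seq wp_assign[OF _ e1])
    subgoal using I by blast
    subgoal by (rule u)
    apply (rule wp_assign[OF _ e2])
    subgoal .
    subgoal using encW L_bounds by simp
    apply (rule wp_assign[OF _ e3])
    subgoal .
    subgoal by (rule iL)
    subgoal using I i ws0(2,4) ws wsX encW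
      by (auto intro!: exI[of _ ws] exI[of _ "i div 2"])
    done
next
  fix s' out'
  assume I: "out' = out \<and> fits V L s' \<and> (\<forall>v. v \<notin> {9, 10, 11} \<longrightarrow> s' v = s v) \<and>
      (\<exists>ws i. set ws \<subseteq> {0..<X} \<and> i < 2 ^ length ws \<and> enc X ws \<le> W \<and> i \<le> j \<and>
         s' 9 = int i \<and> s' 10 = enc X ws \<and> s' 11 = y - shift zs j + shift ws i)"
    and "\<not> eval_expr inp s' (Const 0) < eval_expr inp s' (Var 9)"
  then have "s' 11 = y - shift zs j" by auto
  then show "P s' out'" using I by (auto intro!: post)
qed auto

text \<open>The offset of \<open>bdigit\<close> is added once; afterwards the ordinary digits can be
  split off one at a time.\<close>

definition "residue j = (y - shift zs j + (Q - 1) div 2) mod Q"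
definition "norm_at j = radix_norm h d (y - shift zs j)"

lemma residue_digit: "residue j div M ^ k mod M - h = bdigit h d (y - shift zs j) k"
proof -
  have "bdigit h d a k = (a + (Q - 1) div 2) mod Q div M ^ k mod M - h" for a
    by (simp only: bdigit_def Q M)
  then show ?thesis by (simp only: residue_def)
qed

lemma residue_bounds: "0 \<le> residue j" "residue j < Q"
  using Q_gt by (auto simp: residue_def)

lemma residue_div_bounds: "0 \<le> residue j div M ^ k" "residue j div M ^ k \<le> L"
proof -
  have "1 \<le> M ^ k" using M_gt by (intro one_le_power) auto
  then have "residue j div M ^ k \<le> residue j" "0 \<le> residue j div M ^ k"
    using residue_bounds[of j] zdiv_mono2[of "residue j" 1 "M ^ k"]
    by (auto simp: pos_imp_zdiv_nonneg_iff)
  then show "0 \<le> residue j div M ^ k" "residue j div M ^ k \<le> L"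
    using residue_bounds[of j] L_bounds by linarith+
qed

lemma partial_norm_bounds:
  assumes "k \<le> d"
  shows "0 \<le> (\<Sum>i<k. (bdigit h d a i)\<^sup>2)" "(\<Sum>i<k. (bdigit h d a i)\<^sup>2) \<le> L"
proof -
  show "0 \<le> (\<Sum>i<k. (bdigit h d a i)\<^sup>2)" by (intro sum_nonneg) simp
  have "(bdigit h d a i)\<^sup>2 \<le> h * h" for i
    using bdigit_bounds[of h d a i] h_ge power_mono[of "\<bar>bdigit h d a i\<bar>" h 2]
    by (simp add: power2_eq_square)
  then have "(\<Sum>i<k. (bdigit h d a i)\<^sup>2) \<le> int k * (h * h)"
    using sum_bounded_above[of "{..<k}" "\<lambda>i. (bdigit h d a i)\<^sup>2" "h * h"] by simp
  also have "\<dots> \<le> int d * (h * h)" using assms h_ge by (intro mult_right_mono) auto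
  finally show "(\<Sum>i<k. (bdigit h d a i)\<^sup>2) \<le> L" using L_bounds by linarith
qed

lemma wp_norm:
  assumes fits: "fits V L s" and s: "s 0 = int d" "s 2 = 0" "s 12 = residue j" "s 13 = 0"
    and post: "\<And>s'. fits V L s' \<Longrightarrow> (\<And>v. v \<notin> {2, 12, 13} \<Longrightarrow> s' v = s v) \<Longrightarrow>
                 s' 13 = norm_at j \<Longrightarrow> P s' out"
  shows "wp inp V L norm_prog P s out"
  unfolding norm_prog_def
proof (rule wp_loop[where I = "\<lambda>s' out'. out' = out \<and> fits V L s' \<and>
      (\<exists>k\<le>d. s' = s(13 := \<Sum>i<k. (bdigit h d (y - shift zs j) i)\<^sup>2, 12 := residue j div M ^ k, 2 := int k))"
      and \<mu> = "\<lambda>s. d - nat (s 2)"])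
  let ?b = "bdigit h d (y - shift zs j)"
  let ?s = "\<lambda>k. s(13 := \<Sum>i<k. (?b i)\<^sup>2, 12 := residue j div M ^ k, 2 := int k)"
  have "s = ?s 0" using s by (simp add: fun_eq_iff)
  then show "out = out \<and> fits V L s \<and> (\<exists>k\<le>d. s = ?s k)"
    using fits by blast
  fix s' out'
  {
  assume I: "out' = out \<and> fits V L s' \<and> (\<exists>k\<le>d. s' = ?s k)"
    and "eval_expr inp s' (Var 2) < eval_expr inp s' (Var 0)"
  then obtain k where s': "s' = ?s k" and k: "k < d" using s(1) by auto
  let ?n = "\<Sum>i<Suc k. (?b i)\<^sup>2"
  have e1: "\<lfloor>eval_expr inp s' (Add (Var 13) (Mul (digit_expr 12) (digit_expr 12)))\<rfloor> = ?n"
    using s unfolding s'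
    by (simp only: int_eval prog_eval store_simps residue_digit) (simp add: power2_eq_square)
  have e2: "\<lfloor>eval_expr inp (s'(13 := ?n)) (div_expr (Var 12) radix_expr)\<rfloor> = residue j div M ^ Suc k"
    using s M_gt unfolding s' by (simp only: int_eval prog_eval store_simps power_Suc2) (simp add: zdiv_zmult2_eq)
  show "wp inp V L (Seq (Assign 13 (Add (Var 13) (Mul (digit_expr 12) (digit_expr 12))))
     (Seq (Assign 12 (div_expr (Var 12) radix_expr)) (Assign 2 (Add (Var 2) (Const 1)))))
     (\<lambda>s'' out''. (out'' = out \<and> fits V L s'' \<and> (\<exists>k\<le>d. s'' = ?s k)) \<and>
        d - nat (s'' 2) < d - nat (s' 2)) s' out'"
    apply (intro wp_seq wp_assign[OF _ e1])
    subgoal using I by blast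
    subgoal using partial_norm_bounds[of "Suc k"] k by simp
    apply (rule wp_assign[OF _ e2])
    subgoal .
    subgoal using residue_div_bounds[of j "Suc k"] by linarith
    apply (rule wp_assign[where e = "int (Suc k)"])
    subgoal .
    subgoal by (simp add: s')
    subgoal using k L_bounds by simp
    subgoal premises p
    proof -
      have "s'(13 := ?n, 12 := residue j div M ^ Suc k, 2 := int (Suc k)) = ?s (Suc k)"
        by (simp add: s' fun_eq_iff)
      with p I k show ?thesis by (auto simp: s' intro!: exI[of _ "Suc k"])
    qed
    done
  }
  {
  assume I: "out' = out \<and> fits V L s' \<and> (\<exists>k\<le>d. s' = ?s k)"
    and "\<not> eval_expr inp s' (Var 2) < eval_expr inp s' (Var 0)"
  then have eq: "s' = ?s d" using s(1) by auto
  from I have "fits V L s'" "out' = out" by blast+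
  moreover from this(1) have "P (?s d) out"
    unfolding eq by (rule post) (simp_all add: norm_at_def radix_norm_def)
  ultimately show "P s' out'" unfolding eq by blast
  }
qed auto

end

section \<open>Search for the least winning index\<close>

locale hash_search = hash_scan +
  fixes V :: "nat set" and J :: nat
  assumes J: "J < 2 ^ length zs"
    and wins: "wins S (\<lambda>j. norm_at j \<le> r) (\<lambda>j. norm_at j \<le> r') J"
    and least: "\<And>j. wins S (\<lambda>j. norm_at j \<le> r) (\<lambda>j. norm_at j \<le> r') j \<Longrightarrow> J \<le> j"
begin

definition "ready s \<longleftrightarrow> fits V L s \<and> s 0 = int d \<and> s 1 = W \<and> s 3 = Q \<and> s 4 = y \<and>
   s 5 = r \<and> s 6 = r' \<and> s 7 = int S"

text \<open>Invariant of the search: \<open>J\<close> has not been passed, and a hit at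
  \<open>j\<close> would be the first touch in its block, hence a win.\<close>

definition "pending j \<longleftrightarrow> j \<le> J \<and> (\<forall>i<j. i div S = j div S \<longrightarrow> r' < norm_at i)"

lemma J_le_L: "int J \<le> L"
proof -
  have "int J < 2 ^ length zs" using J by (metis of_nat_less_iff of_nat_numeral of_nat_power)
  then show ?thesis using L_bounds by linarith
qed

lemma pending_hit: "pending j \<Longrightarrow> norm_at j \<le> r \<Longrightarrow> j = J"
  using least[of j] by (auto simp: pending_def wins_def not_le)

lemma pending_Suc:
  assumes "pending j" "r' < norm_at j"
  shows "pending (Suc j)"
proof -
  have "norm_at J \<le> r" using wins by (simp add: wins_def)
  then have "j \<noteq> J" using assms(2) r by auto
  moreover have "r' < norm_at i" if "i < Suc j" "i div S = Suc j div S" for i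
  proof (cases "i = j")
    case False
    then have "i < j" using that by simp
    \<comment> \<open>Block numbers are monotone, so \<open>j\<close> lies in the common block of
      \<open>i\<close> and \<open>Suc j\<close>.\<close>
    then have "i div S \<le> j div S" "j div S \<le> Suc j div S" by (auto intro: div_le_mono)
    then show ?thesis using assms(1) that \<open>i < j\<close> by (auto simp: pending_def)
  qed (use assms in simp)
  ultimately show ?thesis using assms(1) by (auto simp: pending_def)
qed

text \<open>After a touch without a hit no later index of the block can win, so \<open>J\<close>
  lies in a later block. The start of the next block has no predecessor in its own block.\<close>

lemma pending_jump:
  assumes "pending j" "r < norm_at j" "norm_at j \<le> r'"
  shows "pending ((j div S + 1) * S)" "j < (j div S + 1) * S"
proof -
  let ?k = "(j div S + 1) * S"
  have J_hit: "norm_at J \<le> r" "\<And>i. i < J \<Longrightarrow> i div S = J div S \<Longrightarrow> \<not> norm_at i \<le> r'"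
    using wins by (auto simp: wins_def)
  have "j \<le> J" using assms(1) by (simp add: pending_def)
  moreover have "j \<noteq> J" using J_hit assms by auto
  ultimately have "j < J" by simp
  then have "j div S \<noteq> J div S" using J_hit(2)[of j] assms by auto
  moreover have "j div S \<le> J div S" using \<open>j < J\<close> by (intro div_le_mono) simp
  ultimately have "j div S + 1 \<le> J div S" by simp
  then have "?k \<le> J div S * S" by (intro mult_le_mono1)
  also have "\<dots> \<le> J" by simp
  finally have "?k \<le> J" .
  moreover have "?k \<le> i" if "i div S = ?k div S" for i
  proof -
    have "i div S = j div S + 1" using that S by simp
    then have "?k = i div S * S" by simp
    also have "\<dots> \<le> i" by simp
    finally show ?thesis .
  qed
  ultimately show "pending ?k" unfolding pending_def using not_le by blast
  show "j < ?k" using S dividend_less_div_times[of S j] by (simp add: mult.commute)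
qed

lemma wp_advance:
  assumes s: "ready s" "s 8 = int j" "s 11 = residue j" "s 13 = norm_at j" and j: "pending j"
    and post: "\<And>k. pending k \<Longrightarrow> j < k \<Longrightarrow> r < s 13 \<Longrightarrow> ready (s(8 := int k)) \<Longrightarrow> P (s(8 := int k)) out"
    and hit: "j = J \<Longrightarrow> s 13 \<le> r \<Longrightarrow> ready s \<Longrightarrow> P s out"
  shows "wp inp V L advance_prog P s out"
proof -
  have fits: "fits V L s" using s by (simp add: ready_def)
  have up: "ready (s(8 := int k))" if "fits V L (s(8 := int k))" for k
    using s that by (simp add: ready_def)
  have small: "\<bar>int k\<bar> \<le> L" if "pending k" for k
    using that J_le_L by (auto simp: pending_def)
  have regs: "s 5 = r" "s 6 = r'" "s 7 = int S" using s by (auto simp: ready_def)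
  show ?thesis
    unfolding advance_prog_def
  proof (intro wp_cond)
    assume "eval_expr inp s (Var 5) < eval_expr inp s (Var 13)"
      "eval_expr inp s (Var 6) < eval_expr inp s (Var 13)"
    then have "r < norm_at j" "r' < norm_at j" using s regs by auto
    then have p: "pending (Suc j)" using pending_Suc j by blast
    show "wp inp V L (Assign 8 (Add (Var 8) (Const 1))) P s out"
      using s small[OF p] post[OF p] up[of "Suc j"] \<open>r < norm_at j\<close>
      by (intro wp_assign[OF fits, where e = "int (Suc j)"]) auto
  next
    assume "eval_expr inp s (Var 5) < eval_expr inp s (Var 13)"
      "\<not> eval_expr inp s (Var 6) < eval_expr inp s (Var 13)"
    then have n: "r < norm_at j" "norm_at j \<le> r'" using s regs by auto
    note p = pending_jump[OF j n]
    have e: "\<lfloor>eval_expr inp s (Mul (Add (div_expr (Var 8) (Var 7)) (Const 1)) (Var 7))\<rfloor> = int ((j div S + 1) * S)"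
      using s regs by (simp only: int_eval) (simp add: zdiv_int distrib_right)
    show "wp inp V L (Assign 8 (Mul (Add (div_expr (Var 8) (Var 7)) (Const 1)) (Var 7))) P s out"
      using s small[OF p(1)] post[OF p] up[of "(j div S + 1) * S"] n
      by (intro wp_assign[OF fits e]) auto
  next
    assume "\<not> eval_expr inp s (Var 5) < eval_expr inp s (Var 13)"
    then have n: "norm_at j \<le> r" using s regs by auto
    then have "j = J" using pending_hit j by blast
    moreover have "s(8 := int j) = s" using s by (simp add: fun_eq_iff)
    ultimately show "wp inp V L (Assign 8 (Var 8)) P s out"
      using s small[OF j] hit n
      by (intro wp_assign[OF fits, where e = "int j"]) auto
  qed
qed

lemma ready_cong: "ready s \<Longrightarrow> fits V L s' \<Longrightarrow> (\<And>v. v \<in> {0, 1, 3, 4, 5, 6, 7} \<Longrightarrow> s' v = s v) \<Longrightarrow> ready s'"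
  by (simp add: ready_def)

text \<open>Register 13 also serves as the stopping flag: a value of at most \<open>r\<close>
  records a hit at the last index tested. The variant is 0 after a hit, and otherwise decreases as
  the index grows without passing \<open>J\<close>.\<close>

lemma wp_search:
  assumes s: "ready s" "s 8 = 0" "s 13 = r + 1"
    and post: "\<And>s'. ready s' \<Longrightarrow> s' 8 = int J \<Longrightarrow> s' 11 = residue J \<Longrightarrow> P s' out"
  shows "wp inp V L search_prog P s out"
  unfolding search_prog_def
proof (rule wp_loop[where I = "\<lambda>s' out'. out' = out \<and> ready s' \<and>
      ((\<exists>j. s' 8 = int j \<and> pending j \<and> r < s' 13) \<or>
       (s' 8 = int J \<and> s' 11 = residue J \<and> s' 13 \<le> r))"
      and \<mu> = "\<lambda>s. if s 13 \<le> r then 0 else Suc J - nat (s 8)"])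
  have "pending 0" by (simp add: pending_def)
  then show "out = out \<and> ready s \<and> ((\<exists>j. s 8 = int j \<and> pending j \<and> r < s 13) \<or>
       (s 8 = int J \<and> s 11 = residue J \<and> s 13 \<le> r))"
    using s by auto
next
  fix s' out'
  assume I: "out' = out \<and> ready s' \<and> ((\<exists>j. s' 8 = int j \<and> pending j \<and> r < s' 13) \<or>
       (s' 8 = int J \<and> s' 11 = residue J \<and> s' 13 \<le> r))"
    and "eval_expr inp s' (Var 5) < eval_expr inp s' (Var 13)"
  then obtain j where j: "s' 8 = int j" "pending j" "r < s' 13"
    by (auto simp: ready_def)
  have ready: "ready s'" using I by simp
  then have fits: "fits V L s'" by (simp add: ready_def)
  have "j \<le> J" using j(2) by (simp add: pending_def)
  then have jL: "\<bar>int j\<bar> \<le> L" using J_le_L by simp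
  have "j < 2 ^ length zs" using \<open>j \<le> J\<close> J by simp
  have y: "0 \<le> y" "y < Q" using Q_gt by (auto simp: y_def)
  let ?Q = "\<lambda>s'' out''. (out'' = out \<and> ready s'' \<and> ((\<exists>j. s'' 8 = int j \<and> pending j \<and> r < s'' 13) \<or>
       (s'' 8 = int J \<and> s'' 11 = residue J \<and> s'' 13 \<le> r))) \<and>
       (if s'' 13 \<le> r then 0 else Suc J - nat (s'' 8)) < (if s' 13 \<le> r then 0 else Suc J - nat (s' 8))"
  have last: "wp inp V L advance_prog ?Q s\<^sub>3 out'"
    if s3: "fits V L s\<^sub>3" "\<And>v. v \<notin> {2, 9, 10, 11, 12, 13} \<Longrightarrow> s\<^sub>3 v = s' v"
      "s\<^sub>3 11 = residue j" "s\<^sub>3 13 = norm_at j" for s\<^sub>3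
  proof (rule wp_advance[OF _ _ s3(3,4) j(2)])
    show "ready s\<^sub>3" by (rule ready_cong[OF ready s3(1)], rule s3(2)) auto
    show "s\<^sub>3 8 = int j" using s3(2) j by simp
    show "?Q (s\<^sub>3(8 := int k)) out'" if "pending k" "j < k" "r < s\<^sub>3 13" "ready (s\<^sub>3(8 := int k))" for k
      using that I j \<open>j \<le> J\<close> by (auto simp: pending_def)
    show "?Q s\<^sub>3 out'" if "j = J" "s\<^sub>3 13 \<le> r" "ready s\<^sub>3"
      using that I j s3 by auto
  qed
  have middle: "wp inp V L (Seq (Assign 11 (mod_expr (Add (Var 11) (div_expr (Sub (Var 3) (Const 1)) (Const 2))) (Var 3)))
     (Seq (Assign 12 (Var 11)) (Seq (Assign 13 (Const 0)) (Seq (Assign 2 (Const 0))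
     (Seq norm_prog advance_prog))))) ?Q s\<^sub>2 out'"
    if s2: "fits V L s\<^sub>2" "\<And>v. v \<notin> {9, 10, 11} \<Longrightarrow> s\<^sub>2 v = s' v" "s\<^sub>2 11 = y - shift zs j" for s\<^sub>2
  proof -
    have "s\<^sub>2 3 = Q" "s\<^sub>2 0 = int d" using s2(2) ready by (auto simp: ready_def)
    then have e: "\<lfloor>eval_expr inp s\<^sub>2 (mod_expr (Add (Var 11) (div_expr (Sub (Var 3) (Const 1)) (Const 2))) (Var 3))\<rfloor> = residue j"
      using s2(3) by (simp only: int_eval residue_def)
    have rL: "\<bar>residue j\<bar> \<le> L" using residue_bounds[of j] L_bounds by simp
    show ?thesis
      apply (rule wp_seq, rule wp_assign[OF s2(1) e rL])
      apply (rule wp_seq, rule wp_assign[where e = "residue j"])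
      subgoal .
      subgoal by simp
      subgoal by (rule rL)
      apply (rule wp_seq, rule wp_assign[where e = 0])
      subgoal .
      subgoal by simp
      subgoal using L_bounds Q_gt by simp
      apply (rule wp_seq, rule wp_assign[where e = 0])
      subgoal .
      subgoal by simp
      subgoal using L_bounds Q_gt by simp
      apply (rule wp_seq, rule wp_norm[where j = j])
      subgoal .
      subgoal using \<open>s\<^sub>2 0 = int d\<close> by simp
      subgoal by simp
      subgoal by simp
      subgoal by simp
      subgoal by (rule last) (use s2 in simp_all)
      done
  qed
  show "wp inp V L (Seq (Assign 9 (Var 8)) (Seq (Assign 10 (Var 1)) (Seq (Assign 11 (Var 4))
     (Seq shift_prog
     (Seq (Assign 11 (mod_expr (Add (Var 11) (div_expr (Sub (Var 3) (Const 1)) (Const 2))) (Var 3)))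
     (Seq (Assign 12 (Var 11)) (Seq (Assign 13 (Const 0)) (Seq (Assign 2 (Const 0))
     (Seq norm_prog advance_prog))))))))) ?Q s' out'"
    apply (rule wp_seq, rule wp_assign[OF fits, where e = "int j"])
    subgoal using j by simp
    subgoal by (rule jL)
    apply (rule wp_seq, rule wp_assign[where e = W])
    subgoal .
    subgoal using ready by (simp add: ready_def)
    subgoal using W_pos L_bounds by simp
    apply (rule wp_seq, rule wp_assign[where e = y])
    subgoal .
    subgoal using ready by (simp add: ready_def)
    subgoal using y L_bounds by simp
    apply (rule wp_seq, rule wp_shift[where j = j])
    subgoal .
    subgoal using ready by (simp add: ready_def)
    subgoal by simp
    subgoal by simp
    subgoal by simp
    subgoal by (rule \<open>j < 2 ^ length zs\<close>)
    subgoal by (rule middle) simp_all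
    done
next
  fix s' out'
  assume "out' = out \<and> ready s' \<and> ((\<exists>j. s' 8 = int j \<and> pending j \<and> r < s' 13) \<or>
       (s' 8 = int J \<and> s' 11 = residue J \<and> s' 13 \<le> r))"
    and "\<not> eval_expr inp s' (Var 5) < eval_expr inp s' (Var 13)"
  then show "P s' out'" using post by (auto simp: ready_def)
qed (auto simp: ready_def)

definition "output k = (if k < d then of_int (g k - bdigit h d (y - shift zs J) k) + 1 / (real J + 2) else 0)"

lemma wp_output_prog:
  assumes s: "ready s" "s 2 = 0" "s 8 = int J" "s 11 = residue J"
    and post: "\<And>s'. P s' output"
  shows "wp inp V L output_prog P s (\<lambda>_. 0)"
  unfolding output_prog_def
proof (rule wp_loop[where I = "\<lambda>s' out. fits V L s' \<and>
      (\<exists>k\<le>d. s' = s(11 := residue J div M ^ k, 2 := int k) \<and> out = (\<lambda>i. if i < k then output i else 0))"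
      and \<mu> = "\<lambda>s. d - nat (s 2)"])
  let ?s = "\<lambda>k. s(11 := residue J div M ^ k, 2 := int k)"
  let ?o = "\<lambda>k i. if i < k then output i else 0"
  have "s = ?s 0" using s by (simp add: fun_eq_iff)
  moreover have "(\<lambda>_. 0) = ?o 0" by simp
  ultimately show "fits V L s \<and> (\<exists>k\<le>d. s = ?s k \<and> (\<lambda>_. 0) = ?o k)"
    using s(1) unfolding ready_def by blast
  have regs: "s 0 = int d" using s by (simp add: ready_def)
  fix s' out
  {
  assume I: "fits V L s' \<and> (\<exists>k\<le>d. s' = ?s k \<and> out = ?o k)"
    and "eval_expr inp s' (Var 2) < eval_expr inp s' (Var 0)"
  then obtain k where s': "s' = ?s k" and out: "out = ?o k" and k: "k < d" using regs by auto
  have o: "eval_expr inp s' (Add (Sub grid_expr (digit_expr 11)) (Quot (Const 1) (Add (Var 8) (Const 2)))) = output k"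
  proof -
    have "eval_expr inp s' (digit_expr 11) = of_int (bdigit h d (y - shift zs J) k)"
      using regs unfolding s' by (simp only: int_eval prog_eval store_simps residue_digit)
    moreover have "eval_expr inp s' grid_expr = of_int (g k)"
      using regs by (intro grid_eval) (simp_all add: s')
    ultimately have "eval_expr inp s' (Sub grid_expr (digit_expr 11)) = of_int (g k - bdigit h d (y - shift zs J) k)"
      by (simp only: eval_expr.simps of_int_diff)
    then show ?thesis using s(3) k by (simp add: s' output_def)
  qed
  have e2: "\<lfloor>eval_expr inp s' (div_expr (Var 11) radix_expr)\<rfloor> = residue J div M ^ Suc k"
    using regs M_gt unfolding s' by (simp only: int_eval prog_eval store_simps power_Suc2) (simp add: zdiv_zmult2_eq)
  have out': "out(nat \<lfloor>eval_expr inp s' (Var 2)\<rfloor> := output k) = ?o (Suc k)"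
    by (auto simp: out s' fun_eq_iff)
  show "wp inp V L (Seq (Output (Var 2) (Add (Sub grid_expr (digit_expr 11)) (Quot (Const 1) (Add (Var 8) (Const 2)))))
     (Seq (Assign 11 (div_expr (Var 11) radix_expr)) (Assign 2 (Add (Var 2) (Const 1)))))
     (\<lambda>s'' out''. (fits V L s'' \<and> (\<exists>k\<le>d. s'' = ?s k \<and> out'' = ?o k)) \<and> d - nat (s'' 2) < d - nat (s' 2)) s' out"
    apply (intro wp_seq wp_output)
    subgoal using I by blast
    unfolding o out'
    apply (rule wp_assign[OF _ e2])
    subgoal using I by blast
    subgoal using residue_div_bounds[of J "Suc k"] by linarith
    apply (rule wp_assign[where e = "int (Suc k)"])
    subgoal .
    subgoal by (simp add: s')
    subgoal using k L_bounds by simp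
    subgoal premises p
    proof -
      have "s'(11 := residue J div M ^ Suc k, 2 := int (Suc k)) = ?s (Suc k)"
        by (simp add: s' fun_eq_iff)
      with p k show ?thesis
        unfolding s' by (metis (no_types, lifting) Suc_leI diff_less_mono2 fun_upd_same lessI nat_int)
    qed
    done
  }
  {
  assume "fits V L s' \<and> (\<exists>k\<le>d. s' = ?s k \<and> out = ?o k)"
    and "\<not> eval_expr inp s' (Var 2) < eval_expr inp s' (Var 0)"
  then have "out = ?o d" using regs by auto
  also have "\<dots> = output" by (auto simp: output_def)
  finally show "P s' out" using post by simp
  }
qed auto

lemma wp_hash_prog:
  assumes "\<And>s. P s output"
  shows "wp inp V L hash_prog P ((\<lambda>_. 0)(0 := int d, 1 := L)) (\<lambda>_. 0)"
proof -
  let ?s = "(\<lambda>_. 0)(0 := int d, 1 := L) :: store"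
  have "fits V L ?s" using L_bounds Q_gt by (simp add: fits_def)
  then show ?thesis
    unfolding hash_prog_def
    apply (rule wp_seq[OF wp_assign[where e = 1]])
    subgoal by simp
    subgoal using L_bounds Q_gt by simp
    apply (rule wp_seq[OF wp_power])
    subgoal .
    subgoal by simp
    subgoal by simp
    subgoal by simp
    apply (rule wp_seq[OF wp_grid])
    subgoal .
    subgoal by simp
    subgoal by simp
    subgoal by simp
    subgoal by simp
    \<comment> \<open>Three digits are split off the description in turn; what remains in register 1
      is \<open>W\<close>, the packed generators.\<close>
    apply (rule wp_seq[OF wp_load[where z = r and w = "r' + X * (int S + X * W)"]])
    subgoal .
    subgoal by simp
    subgoal by (simp add: L_eq)
    subgoal by simp
    subgoal using r by simp
    subgoal using r by simp
    subgoal using parts_le S W_pos X_ge r by simp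
    subgoal using parts_le by simp
    apply (rule wp_seq[OF wp_load[where z = r' and w = "int S + X * W"]])
    subgoal .
    subgoal by simp
    subgoal by simp
    subgoal by simp
    subgoal using r by simp
    subgoal using r by simp
    subgoal using parts_le S W_pos X_ge r by simp
    subgoal using parts_le by linarith
    apply (rule wp_seq[OF wp_load[where z = "int S" and w = W]])
    subgoal .
    subgoal by simp
    subgoal by simp
    subgoal by simp
    subgoal by simp
    subgoal using S by simp
    subgoal using W_pos by simp
    subgoal using L_bounds by simp
    \<comment> \<open>Any value above \<open>r\<close> would do; it makes the search loop
      start.\<close>
    apply (rule wp_seq[OF wp_assign[where e = "r + 1"]])
    subgoal .
    subgoal by simp
    subgoal using r L_bounds by simp
    apply (rule wp_seq[OF wp_search])
    subgoal by (simp add: ready_def)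
    subgoal by simp
    subgoal by simp
    apply (rule wp_seq[OF wp_assign[where e = 0]])
    subgoal by (simp add: ready_def)
    subgoal by simp
    subgoal using L_bounds Q_gt by simp
    apply (rule wp_output_prog)
    subgoal by (erule ready_cong) auto
    subgoal by simp
    subgoal by simp
    subgoal by simp
    subgoal by (rule assms)
    done
qed

end

section \<open>The partition\<close>

definition grid_code :: "int \<Rightarrow> nat \<Rightarrow> (nat \<Rightarrow> int) \<Rightarrow> int" where
  "grid_code h d u = (\<Sum>k<d. u k * (2*h+1)^k) mod (2*h+1)^d"

text \<open>Subtracting \<open>u - v\<close> from the balanced digits for \<open>u\<close> gives a
  vector of length at most \<open>R + \<Delta> \<le> h\<close> with the residue of \<open>v\<close>,
  so it consists of the balanced digits for \<open>v\<close>. In particular the centre, grid vector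
  minus digits, is the same for both.\<close>

lemma translate_digits:
  assumes h: "0 \<le> h" and uv: "L2_set (\<lambda>k. real_of_int (u k - v k)) {..<d} \<le> \<Delta>"
    and R: "sqrt (of_int (radix_norm h d (grid_code h d u - s))) \<le> R" "R + \<Delta> \<le> of_int h"
  shows "k < d \<Longrightarrow> bdigit h d (grid_code h d v - s) k = bdigit h d (grid_code h d u - s) k - (u k - v k)"
    and "sqrt (of_int (radix_norm h d (grid_code h d v - s))) \<le> R + \<Delta>"
proof -
  define b where "b k = bdigit h d (grid_code h d u - s) k" for k
  define w where "w k = b k - (u k - v k)" for k
  define M where "M = 2 * h + 1"
  have "L2_set (\<lambda>k. real_of_int (w k)) {..<d} = L2_set (\<lambda>k. real_of_int (b k) + - real_of_int (u k - v k)) {..<d}"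
    by (rule L2_set_cong) (auto simp: w_def)
  also have "\<dots> \<le> L2_set (\<lambda>k. real_of_int (b k)) {..<d} + L2_set (\<lambda>k. - real_of_int (u k - v k)) {..<d}"
    by (rule L2_set_triangle_ineq)
  also have "L2_set (\<lambda>k. - real_of_int (u k - v k)) {..<d} = L2_set (\<lambda>k. real_of_int (u k - v k)) {..<d}"
    by (simp only: L2_set_def power2_minus)
  also have "L2_set (\<lambda>k. real_of_int (b k)) {..<d} \<le> R"
    using R(1) unfolding b_def L2_set_bdigit .
  finally have w: "L2_set (\<lambda>k. real_of_int (w k)) {..<d} \<le> R + \<Delta>" using uv by linarith
  have wh: "\<bar>w k\<bar> \<le> h" if "k < d" for k
  proof -
    have "\<bar>real_of_int (w k)\<bar> \<le> L2_set (\<lambda>k. \<bar>real_of_int (w k)\<bar>) {..<d}"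
      using that by (intro member_le_L2_set) auto
    also have "\<dots> = L2_set (\<lambda>k. real_of_int (w k)) {..<d}" by (simp add: L2_set_def)
    finally show ?thesis using w R(2) by linarith
  qed
  have b: "(\<Sum>k<d. b k * M^k) mod M^d = (grid_code h d u - s) mod M^d"
    unfolding b_def M_def by (rule sum_bdigit[OF h])
  have "(\<Sum>k<d. w k * M^k) = (\<Sum>k<d. b k * M^k) - ((\<Sum>k<d. u k * M^k) - (\<Sum>k<d. v k * M^k))"
    by (simp add: w_def left_diff_distrib sum_subtractf)
  also have "\<dots> mod M^d = ((grid_code h d u - s) - ((\<Sum>k<d. u k * M^k) - (\<Sum>k<d. v k * M^k))) mod M^d"
    by (rule mod_diff_cong[OF b refl])
  also have "\<dots> = (((\<Sum>k<d. u k * M^k) - s) - ((\<Sum>k<d. u k * M^k) - (\<Sum>k<d. v k * M^k))) mod M^d"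
    unfolding grid_code_def M_def[symmetric] by (simp only: mod_diff_left_eq mod_diff_cong[OF mod_diff_left_eq refl])
  also have "\<dots> = ((\<Sum>k<d. v k * M^k) - s) mod M^d" by (simp add: algebra_simps)
  also have "\<dots> = (grid_code h d v - s) mod M^d"
    unfolding grid_code_def M_def[symmetric] by (rule mod_diff_left_eq[symmetric])
  finally have eq: "bdigit h d (grid_code h d v - s) k = w k" if "k < d" for k
    using bdigit_unique[of d w h "grid_code h d v - s" k] wh that unfolding M_def by simp
  then show "k < d \<Longrightarrow> bdigit h d (grid_code h d v - s) k = bdigit h d (grid_code h d u - s) k - (u k - v k)"
    by (simp add: w_def b_def)
  have "L2_set (\<lambda>k. real_of_int (bdigit h d (grid_code h d v - s) k)) {..<d} = L2_set (\<lambda>k. real_of_int (w k)) {..<d}"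
    using eq by (intro L2_set_cong) auto
  then show "sqrt (of_int (radix_norm h d (grid_code h d v - s))) \<le> R + \<Delta>"
    using w by (simp add: L2_set_bdigit)
qed

text \<open>Rounding changes each coordinate of the difference by at most 1, hence its length by at
  most \<open>sqrt d\<close>.\<close>

lemma floor_scaled_dist:
  fixes c :: real
  assumes "0 \<le> c"
  shows "L2_set (\<lambda>k. real_of_int (\<lfloor>x k * c\<rfloor> - \<lfloor>y k * c\<rfloor>)) {..<d} \<le> c * edist d x y + sqrt (real d)"
    and "c * edist d x y \<le> L2_set (\<lambda>k. real_of_int (\<lfloor>x k * c\<rfloor> - \<lfloor>y k * c\<rfloor>)) {..<d} + sqrt (real d)"
proof -
  let ?e = "\<lambda>k. real_of_int (\<lfloor>x k * c\<rfloor> - \<lfloor>y k * c\<rfloor>) - c * (x k - y k)"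
  have scale: "c * edist d x y = L2_set (\<lambda>k. c * (x k - y k)) {..<d}"
    unfolding edist_def by (rule L2_set_right_distrib[OF assms])
  have "L2_set (\<lambda>k. \<bar>?e k\<bar>) {..<d} \<le> L2_set (\<lambda>k. 1) {..<d}"
  proof (rule L2_set_mono)
    fix k
    have "c * (x k - y k) = x k * c - y k * c" by (simp add: algebra_simps)
    then show "\<bar>?e k\<bar> \<le> 1" by linarith
  qed auto
  then have e: "L2_set ?e {..<d} \<le> sqrt (real d)" by (simp add: L2_set_def)
  have "L2_set (\<lambda>k. real_of_int (\<lfloor>x k * c\<rfloor> - \<lfloor>y k * c\<rfloor>)) {..<d} = L2_set (\<lambda>k. c * (x k - y k) + ?e k) {..<d}"
    by simp
  also have "\<dots> \<le> L2_set (\<lambda>k. c * (x k - y k)) {..<d} + L2_set ?e {..<d}"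
    by (rule L2_set_triangle_ineq)
  finally show "L2_set (\<lambda>k. real_of_int (\<lfloor>x k * c\<rfloor> - \<lfloor>y k * c\<rfloor>)) {..<d} \<le> c * edist d x y + sqrt (real d)"
    using e scale by linarith
  have "L2_set (\<lambda>k. c * (x k - y k)) {..<d} =
      L2_set (\<lambda>k. real_of_int (\<lfloor>x k * c\<rfloor> - \<lfloor>y k * c\<rfloor>) + - ?e k) {..<d}"
    by simp
  also have "\<dots> \<le> L2_set (\<lambda>k. real_of_int (\<lfloor>x k * c\<rfloor> - \<lfloor>y k * c\<rfloor>)) {..<d} + L2_set (\<lambda>k. - ?e k) {..<d}"
    by (rule L2_set_triangle_ineq)
  also have "L2_set (\<lambda>k. - ?e k) {..<d} = L2_set ?e {..<d}" by (simp only: L2_set_def power2_minus)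
  finally show "c * edist d x y \<le> L2_set (\<lambda>k. real_of_int (\<lfloor>x k * c\<rfloor> - \<lfloor>y k * c\<rfloor>)) {..<d} + sqrt (real d)"
    using e scale by linarith
qed

lemma edist_le_ediam:
  assumes "x \<in> S" "y \<in> S" "ediam d S \<le> ennreal B" "0 \<le> B"
  shows "edist d x y \<le> B"
proof -
  have "ennreal (edist d x y) \<le> ediam d S"
    unfolding ediam_def using assms(1,2) by (auto intro!: SUP_upper2[of "(x, y)"])
  then have "ennreal (edist d x y) \<le> ennreal B" using assms(3) by (rule order_trans)
  then show ?thesis using assms(4) by simp
qed

lemma ediam_le: "(\<And>x y. x \<in> S \<Longrightarrow> y \<in> S \<Longrightarrow> edist d x y \<le> B) \<Longrightarrow> ediam d S \<le> ennreal B"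
  unfolding ediam_def by (auto intro!: SUP_least ennreal_leI)

definition grid :: "int \<Rightarrow> real \<Rightarrow> (nat \<Rightarrow> real) \<Rightarrow> nat \<Rightarrow> int" where
  "grid h l x k = \<lfloor>x k * (of_int h / l)\<rfloor>"

definition cell_norm :: "nat \<Rightarrow> int \<Rightarrow> real \<Rightarrow> int list \<Rightarrow> (nat \<Rightarrow> real) \<Rightarrow> nat \<Rightarrow> int" where
  "cell_norm d h l zs x j = radix_norm h d (grid_code h d (grid h l x) - shift zs j)"

definition cell_index :: "nat \<Rightarrow> int \<Rightarrow> real \<Rightarrow> int list \<Rightarrow> nat \<Rightarrow> int \<Rightarrow> int \<Rightarrow> (nat \<Rightarrow> real) \<Rightarrow> nat" where
  "cell_index d h l zs S r r' x =
     (LEAST j. wins S (\<lambda>j. cell_norm d h l zs x j \<le> r) (\<lambda>j. cell_norm d h l zs x j \<le> r') j)"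

definition ball_hash :: "nat \<Rightarrow> int \<Rightarrow> real \<Rightarrow> int list \<Rightarrow> nat \<Rightarrow> int \<Rightarrow> int \<Rightarrow> (nat \<Rightarrow> real) \<Rightarrow> nat \<Rightarrow> real" where
  "ball_hash d h l zs S r r' x k =
     (if k < d
      then of_int (grid h l x k
             - bdigit h d (grid_code h d (grid h l x) - shift zs (cell_index d h l zs S r r' x)) k)
           + 1 / (real (cell_index d h l zs S r r' x) + 2)   \<comment> \<open>tags an integral centre with the index\<close>
      else 0)"

text \<open>Real radii can be replaced by integral squared radii without loss, because squared norms
  are integers.\<close>

lemma sqrt_le_iff_le_floor: "0 \<le> B \<Longrightarrow> sqrt (of_int n) \<le> B \<longleftrightarrow> n \<le> \<lfloor>B\<^sup>2\<rfloor>"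
  using real_sqrt_le_iff[of "of_int n" "B\<^sup>2"] by (simp add: le_floor_iff)

text \<open>Points with equal values have the same integral centre within distance \<open>R\<close>
  of both, which bounds the fibres. Points at distance at most \<open>l / \<Gamma>\<close> with
  winning indices in the same block have equal values, so a small set meets at most one value per
  block.\<close>

lemma is_hash_ball_hash:
  fixes R \<Delta> :: real
  assumes d: "0 < d" and h: "0 < h" and l: "0 < l" and \<Gamma>: "0 < \<Gamma>" and R: "0 \<le> R"
    and \<Delta>: "\<Delta> = of_int h / \<Gamma> + sqrt (real d)"
    and diam: "2 * R + sqrt (real d) \<le> of_int h" and room: "R + \<Delta> \<le> of_int h"
    and r: "r = \<lfloor>R\<^sup>2\<rfloor>" "r' = \<lfloor>(R + \<Delta>)\<^sup>2\<rfloor>"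
    and ex: "\<And>x. \<exists>j<N * S. wins S (\<lambda>j. cell_norm d h l zs x j \<le> r) (\<lambda>j. cell_norm d h l zs x j \<le> r') j"
    and \<Lambda>: "real N \<le> \<Lambda>"
  shows "is_hash d \<Gamma> \<Lambda> l (ball_hash d h l zs S r r')"
proof -
  let ?\<phi> = "ball_hash d h l zs S r r'" and ?J = "cell_index d h l zs S r r'"
  let ?b = "\<lambda>x j. bdigit h d (grid_code h d (grid h l x) - shift zs j)"
  let ?n = "\<lambda>x j. sqrt (of_int (radix_norm h d (grid_code h d (grid h l x) - shift zs j)))"
  define c where "c = of_int h / l"
  have c: "0 < c" using h l by (simp add: c_def)
  have \<Delta>0: "0 \<le> \<Delta>" unfolding \<Delta> using h \<Gamma> by simp
  have norm_r: "cell_norm d h l zs x j \<le> r \<longleftrightarrow> ?n x j \<le> R"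
    "cell_norm d h l zs x j \<le> r' \<longleftrightarrow> ?n x j \<le> R + \<Delta>" for x j
    using sqrt_le_iff_le_floor[of R] sqrt_le_iff_le_floor[of "R + \<Delta>"] R \<Delta>0 unfolding cell_norm_def r by auto
  have J_less: "?J x < N * S" and J_wins: "wins S (\<lambda>j. ?n x j \<le> R) (\<lambda>j. ?n x j \<le> R + \<Delta>) (?J x)" for x
  proof -
    obtain j where j: "j < N * S"
      "wins S (\<lambda>j. cell_norm d h l zs x j \<le> r) (\<lambda>j. cell_norm d h l zs x j \<le> r') j"
      using ex by blast
    have "?J x \<le> j" unfolding cell_index_def by (rule Least_le) (rule j(2))
    then show "?J x < N * S" using j(1) by simp
    show "wins S (\<lambda>j. ?n x j \<le> R) (\<lambda>j. ?n x j \<le> R + \<Delta>) (?J x)"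
      unfolding cell_index_def norm_r[symmetric] by (rule LeastI[where P = "wins _ _ _"]) (rule j(2))
  qed
  \<comment> \<open>The tag lies strictly between 0 and 1, as its denominator is at least 2;
    rounding down recovers the centre.\<close>
  have floor\<phi>: "\<lfloor>?\<phi> x k\<rfloor> = grid h l x k - ?b x (?J x) k" if "k < d" for x k
  proof -
    have "0 < 1 / (real (?J x) + 2)" "1 / (real (?J x) + 2) < 1" by auto
    then show ?thesis using that unfolding ball_hash_def by (simp add: floor_unique)
  qed
  have grid_diff: "L2_set (\<lambda>k. real_of_int (grid h l x k - grid h l y k)) {..<d} \<le> c * edist d x y + sqrt (real d)"
    "c * edist d x y \<le> L2_set (\<lambda>k. real_of_int (grid h l x k - grid h l y k)) {..<d} + sqrt (real d)" for x y
    using floor_scaled_dist[where c = c and x = x and y = y and d = d] c by (auto simp: grid_def c_def)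
  have RR: "?\<phi> \<in> RR d \<rightarrow> RR d"
    by (auto simp: topspace_Euclidean_space ball_hash_def)
  have small: "edist d x y \<le> l" if eq: "?\<phi> x = ?\<phi> y" for x y
  proof -
    have bb: "grid h l x k - grid h l y k = ?b x (?J x) k - ?b y (?J y) k" if "k < d" for k
      using floor\<phi>[where x = x, OF that] floor\<phi>[where x = y, OF that] eq by simp
    have "L2_set (\<lambda>k. real_of_int (grid h l x k - grid h l y k)) {..<d} =
        L2_set (\<lambda>k. real_of_int (?b x (?J x) k) + - real_of_int (?b y (?J y) k)) {..<d}"
      by (rule L2_set_cong) (auto simp: bb)
    also have "\<dots> \<le> L2_set (\<lambda>k. real_of_int (?b x (?J x) k)) {..<d} + L2_set (\<lambda>k. - real_of_int (?b y (?J y) k)) {..<d}"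
      by (rule L2_set_triangle_ineq)
    also have "L2_set (\<lambda>k. - real_of_int (?b y (?J y) k)) {..<d} = L2_set (\<lambda>k. real_of_int (?b y (?J y) k)) {..<d}"
      by (simp only: L2_set_def power2_minus)
    also have "L2_set (\<lambda>k. real_of_int (?b x (?J x) k)) {..<d} + L2_set (\<lambda>k. real_of_int (?b y (?J y) k)) {..<d} \<le> R + R"
      using J_wins[of x] J_wins[of y] unfolding L2_set_bdigit wins_def by linarith
    finally have "c * edist d x y \<le> c * l"
      using grid_diff(2)[of x y] diam l by (simp add: c_def)
    then show ?thesis using c by simp
  qed
  have same: "?\<phi> x = ?\<phi> y" if xy: "edist d x y \<le> l / \<Gamma>" "edist d y x \<le> l / \<Gamma>" and J: "?J x div S = ?J y div S" for x y
  proof -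
    have cl: "c * (l / \<Gamma>) + sqrt (real d) = \<Delta>" using l by (simp add: \<Delta> c_def)
    have near: "L2_set (\<lambda>k. real_of_int (grid h l x k - grid h l y k)) {..<d} \<le> \<Delta>" if "edist d x y \<le> l / \<Gamma>" for x y
      using grid_diff(1)[of x y] mult_left_mono[OF that, of c] c cl by linarith
    have touch: "?n y (?J x) \<le> R + \<Delta>" if "edist d x y \<le> l / \<Gamma>" for x y
      using translate_digits(2)[OF _ near[OF that] _ room] J_wins[of x] h unfolding wins_def by auto
    \<comment> \<open>The winning ball of either point touches the other one, so the smaller index
      would be a forbidden earlier touch in the block of the larger.\<close>
    have "\<not> ?J x < ?J y" "\<not> ?J y < ?J x"
      using touch[OF xy(1)] touch[OF xy(2)] J_wins[of x] J_wins[of y] J unfolding wins_def by auto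
    then have J_eq: "?J x = ?J y" by simp
    have "grid h l y k - ?b y (?J y) k = grid h l x k - ?b x (?J x) k" if "k < d" for k
      using translate_digits(1)[OF _ near[OF xy(1)] _ room that, of "shift zs (?J x)"] J_wins[of x] h
      unfolding wins_def J_eq by simp
    then show ?thesis by (auto simp: ball_hash_def fun_eq_iff J_eq)
  qed
  show ?thesis
    unfolding is_hash_def
  proof (intro conjI ballI allI impI l RR)
    fix z show "ediam d {x \<in> RR d. ?\<phi> x = z} \<le> ennreal l"
      by (rule ediam_le) (use small in auto)
  next
    fix U assume U: "U \<subseteq> RR d \<and> ediam d U \<le> ennreal (l / \<Gamma>)"
    have near: "edist d x y \<le> l / \<Gamma>" if "x \<in> U" "y \<in> U" for x y
      using edist_le_ediam[OF that] U l \<Gamma> by simp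
    \<comment> \<open>One representative of \<open>U\<close> per block; by \<open>same\<close> it
      has the hash value of all points of \<open>U\<close> in that block.\<close>
    let ?f = "\<lambda>b. ?\<phi> (SOME x. x \<in> U \<and> ?J x div S = b)"
    have sub: "?\<phi> ` U \<subseteq> ?f ` {..<N}"
    proof
      fix z assume "z \<in> ?\<phi> ` U"
      then obtain x where x: "x \<in> U" "z = ?\<phi> x" by blast
      let ?x = "SOME x'. x' \<in> U \<and> ?J x' div S = ?J x div S"
      have "?x \<in> U \<and> ?J ?x div S = ?J x div S"
        by (rule someI[of _ x]) (use x in simp)
      then have "z = ?f (?J x div S)"
        unfolding x using x by (intro same near) auto
      moreover have "?J x div S < N"
        using J_less[of x] by (simp add: less_mult_imp_div_less)
      ultimately show "z \<in> ?f ` {..<N}" by blast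
    qed
    then show "finite (?\<phi> ` U)" by (rule finite_subset) simp
    have "card (?\<phi> ` U) \<le> card (?f ` {..<N})" by (rule card_mono[OF _ sub]) simp
    also have "\<dots> \<le> N" using card_image_le[of "{..<N}" ?f] by simp
    finally show "real (card (?\<phi> ` U)) \<le> \<Lambda>" using \<Lambda> by linarith
  qed
qed

section \<open>Descriptions as bit strings and the program run on them\<close>

text \<open>The string consists of the binary digits without the leading 1, obtained by repeated
  halving.\<close>

lemma exists_bits: "1 \<le> n \<Longrightarrow> \<exists>w. horner_sum of_bool 2 (w @ [True]) = int n \<and> 2 ^ length w \<le> n"
proof (induction n rule: less_induct)
  case (less n)
  show ?case
  proof (cases "n = 1")
    case False
    then have "1 \<le> n div 2" using less.prems by linarith
    then obtain w where w: "horner_sum of_bool 2 (w @ [True]) = int (n div 2)" "2 ^ length w \<le> n div 2"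
      using less.IH[of "n div 2"] less.prems by (meson div_less_dividend less_le_trans one_less_numeral_iff semiring_norm(76) zero_less_one)
    have "int (n mod 2) + 2 * int (n div 2) = int n" 
      by (metis mod_mult_div_eq of_nat_add of_nat_mult of_nat_numeral)
    moreover have "int (n mod 2) = of_bool (odd n)" by (simp add: mod2_eq_if)
    ultimately have "int n = of_bool (odd n) + 2 * int (n div 2)" by simp
    then show ?thesis using w by (intro exI[of _ "odd n # w"]) auto
  qed (auto intro!: exI[of _ "[]"])
qed

lemma evaluates_hash:
  assumes "4 \<le> d" "h = 1000 * (int d * int d)" "M = 2 * h + 1" "Q = M ^ d"
    "X = Q * Q * (Q * Q) * (Q * Q)" "0 \<le> r" "r \<le> r'" "r' < X" "0 < S" "int S < X"
    "set zs \<subseteq> {0..<X}"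
    and ex: "\<exists>j<2 ^ length zs. wins S (\<lambda>j. cell_norm d h l zs x j \<le> r) (\<lambda>j. cell_norm d h l zs x j \<le> r') j"
    and w: "horner_sum of_bool 2 (w @ [True]) = enc X (r # r' # int S # zs)"
    and B: "real (capacity (vars_com hash_prog) (enc X (r # r' # int S # zs))) \<le> B"
  shows "evaluates_in_space hash_prog d \<Gamma> l w x (ball_hash d h l zs S r r' x) B"
proof -
  let ?J = "cell_index d h l zs S r r' x"
  interpret hash_scan d h M Q X l \<Gamma> x r r' S zs
    using assms by unfold_locales auto
  have g: "g = grid h l x" by (simp add: fun_eq_iff g_def grid_def)
  have y: "y = grid_code h d (grid h l x)" 
    unfolding y_def grid_code_def g by (simp only: Q M)
  have n: "norm_at = cell_norm d h l zs x" by (simp add: fun_eq_iff norm_at_def cell_norm_def y)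
  obtain j where j: "j < 2 ^ length zs" "wins S (\<lambda>j. norm_at j \<le> r) (\<lambda>j. norm_at j \<le> r') j"
    using ex unfolding n by blast
  have J: "?J = (LEAST j. wins S (\<lambda>j. norm_at j \<le> r) (\<lambda>j. norm_at j \<le> r') j)"
    unfolding cell_index_def n ..
  have least: "?J \<le> i" if "wins S (\<lambda>j. norm_at j \<le> r) (\<lambda>j. norm_at j \<le> r') i" for i
    unfolding J by (rule Least_le) (rule that)
  have wins: "wins S (\<lambda>j. norm_at j \<le> r) (\<lambda>j. norm_at j \<le> r') ?J"
    unfolding J by (rule LeastI[where P = "wins _ _ _"]) (rule j(2))
  interpret hash_search d h M Q X l \<Gamma> x r r' S zs "vars_com hash_prog" ?J
    using least[OF j(2)] j(1) wins least by unfold_locales auto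
  have "output = ball_hash d h l zs S r r' x"
    by (simp add: fun_eq_iff output_def ball_hash_def g y)
  then have "wp inp (vars_com hash_prog) L hash_prog (\<lambda>_ out. out = ball_hash d h l zs S r r' x)
      ((\<lambda>_. 0)(0 := int d, 1 := L)) (\<lambda>_. 0)"
    by (intro wp_hash_prog) simp
  then show ?thesis
    using w B unfolding wp_def evaluates_in_space_def initial_store_def inp_def L_def
    by (metis (no_types, lifting) of_nat_mono order_trans)
qed

section \<open>Logarithmic size estimates and the choice of parameters\<close>

lemma power_two_above:
  fixes c :: real
  assumes "1 \<le> c"
  shows "\<exists>n. c < 2 ^ n \<and> 2 ^ n \<le> 2 * c"
proof -
  have "1 \<le> nat \<lfloor>c\<rfloor>" using assms by linarith
  then obtain n where n: "2 ^ n \<le> nat \<lfloor>c\<rfloor>" "nat \<lfloor>c\<rfloor> < 2 ^ (n + 1)"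
    using ex_power_ivl1[of 2 "nat \<lfloor>c\<rfloor>"] by auto
  have f: "real (nat \<lfloor>c\<rfloor>) = of_int \<lfloor>c\<rfloor>" using assms by simp
  have "real (2 ^ n) \<le> of_int \<lfloor>c\<rfloor>" using n(1) unfolding f[symmetric] of_nat_le_iff .
  moreover have "real (nat \<lfloor>c\<rfloor> + 1) \<le> real (2 ^ (n + 1))" using n(2) unfolding of_nat_le_iff by simp
  ultimately have "real (2 ^ n) \<le> c" "c < real (2 ^ (n + 1))"
    using f unfolding of_nat_add by linarith+
  then show ?thesis by (intro exI[of _ "n + 1"]) simp
qed

lemma half_le_ln_2: "1 / 2 \<le> ln (2::real)"
proof -
  have "exp (1/2) ^ 2 \<le> (2::real) ^ 2"
    using exp_le by (simp add: power2_eq_square flip: exp_add)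
  then have "exp (1/2) \<le> (2::real)" by (rule power2_le_imp_le) simp
  then show ?thesis by (subst ln_ge_iff) auto
qed

lemma power_two_le_imp: "2 ^ n \<le> c \<Longrightarrow> real n \<le> 2 * ln c"
proof -
  assume c: "2 ^ n \<le> c"
  have "0 < (2::real) ^ n" by simp
  then have "ln (2 ^ n) \<le> ln c" using c by (intro ln_mono) auto
  then have "real n * ln 2 \<le> ln c" by (simp add: ln_realpow)
  moreover have "real n * (1 / 2) \<le> real n * ln 2" using half_le_ln_2 by (intro mult_left_mono) auto
  ultimately show ?thesis by simp
qed

text \<open>For \<open>d \<ge> 4\<close> the radix is at most
  \<open>4096 * d^2 = 4^6 * d^2 \<le> d^8\<close>.\<close>

lemma radix_ln_le:
  assumes "4 \<le> d"
  shows "ln (of_int (2 * (1000 * (int d)\<^sup>2) + 1)) \<le> 8 * ln (real d)"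
proof -
  have "(1::real) * 4 ^ 6 \<le> real d ^ 6" using assms power_mono[of 4 "real d" 6] by simp
  then have "4096 * (real d)\<^sup>2 \<le> real d ^ 6 * (real d)\<^sup>2" by (intro mult_right_mono) auto
  also have "\<dots> = real d ^ 8" by (simp flip: power_add)
  finally have "4096 * (real d)\<^sup>2 \<le> real d ^ 8" .
  moreover have "1 \<le> (real d)\<^sup>2" using assms by (intro one_le_power) auto
  ultimately have "of_int (2 * (1000 * (int d)\<^sup>2) + 1) \<le> real d ^ 8" by simp
  moreover have "0 < real_of_int (2 * (1000 * (int d)\<^sup>2) + 1)" by (simp add: add_nonneg_pos)
  ultimately have "ln (of_int (2 * (1000 * (int d)\<^sup>2) + 1)) \<le> ln (real d ^ 8)" by (intro ln_mono) auto
  then show ?thesis using assms by (simp add: ln_realpow)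
qed

text \<open>With \<open>D = d * ln d\<close>, both \<open>ln Q\<close> and the numbers
  \<open>T\<close> and \<open>t\<close> of generators are \<open>O(D)\<close>. The description packs
  \<open>O(D)\<close> numbers of \<open>O(D)\<close> bits each.\<close>

lemma hash_construction:
  fixes d :: nat and \<Gamma> l :: real
  assumes \<Gamma>: "8 \<le> \<Gamma>" "\<Gamma> \<le> 2 * real d" and l: "0 < l"
  shows "\<exists>\<phi> w. is_hash d \<Gamma> (exp (8 * real d / \<Gamma>) * (64 * (real d * ln (real d)))) l \<phi> \<and>
    real (length w) \<le> 10000 * (real d * ln (real d))\<^sup>2 \<and>
    (\<forall>x. evaluates_in_space hash_prog d \<Gamma> l w x (\<phi> x)
           (real (card (vars_com hash_prog)) * 10002 * (real d * ln (real d))\<^sup>2))"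
proof -
  define E D where "E = exp (8 * real d / \<Gamma>)" and D_def: "D = real d * ln (real d)"
  have d: "4 \<le> d" using \<Gamma> by linarith
  have "exp 1 \<le> real d" using exp_le d by linarith
  then have ln_d: "1 \<le> ln (real d)" using d by (simp add: ln_ge_iff)
  then have "real d * 1 \<le> D" unfolding D_def by (intro mult_left_mono) auto
  then have dD: "real d \<le> D" by simp
  then have D4: "4 \<le> D" using d by linarith
  define h where "h = 1000 * (int d)\<^sup>2"
  define M where "M = 2 * h + 1"
  define Q where "Q = M ^ d"
  define X where "X = Q * Q * (Q * Q) * (Q * Q)"
  have h_eq: "h = 1000 * (int d * int d)" by (simp add: h_def power2_eq_square)
  interpret scan: hash_params d h M Q X
    by unfold_locales (simp_all add: d h_eq M_def Q_def X_def)
  note Q_gt = scan.Q_gt and X_ge = scan.X_ge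
  have lnQ: "ln (real_of_int Q) \<le> 8 * D"
  proof -
    have "ln (real_of_int Q) = real d * ln (real_of_int M)"
      using scan.M_gt by (simp add: Q_def ln_realpow)
    also have "\<dots> \<le> real d * (8 * ln (real d))"
      unfolding M_def h_def using radix_ln_le[OF d] by (intro mult_left_mono) auto
    finally show ?thesis by (simp add: D_def)
  qed
  have lnQ1: "1 \<le> ln (real_of_int Q)"
    using exp_le Q_gt(2) by (simp add: ln_ge_iff)
  define \<Delta> where "\<Delta> = real_of_int h / \<Gamma> + sqrt (real d)"
  obtain R where R: "0 \<le> R" "2 * R + sqrt (real d) \<le> h" "R + \<Delta> \<le> h"
    "real (card (zball d h (R + \<Delta>))) \<le> E * real (card (zball d h R))"
    using exists_radius[OF \<Gamma> h_def] unfolding \<Delta>_def E_def by blast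
  have h0: "0 < h" using scan.h_ge by simp
  have \<Delta>0: "0 \<le> \<Delta>" unfolding \<Delta>_def using h0 \<Gamma> by simp
  define r r' where "r = \<lfloor>R\<^sup>2\<rfloor>" and "r' = \<lfloor>(R + \<Delta>)\<^sup>2\<rfloor>"
  have r: "0 \<le> r" "r \<le> r'"
    unfolding r_def r'_def using R \<Delta>0 by (auto intro!: floor_mono power_mono)
  have r'X: "r' < X"
  proof -
    have "(R + \<Delta>)\<^sup>2 \<le> (of_int h)\<^sup>2" using R \<Delta>0 by (intro power_mono) auto
    then have "r' \<le> h ^ 2" unfolding r'_def by (metis floor_mono floor_of_int of_int_power)
    also have "h ^ 2 < M ^ 2" using h0 by (intro power_strict_mono) (auto simp: M_def)
    also have "M ^ 2 \<le> M ^ 4" using scan.M_gt by (intro power_increasing) auto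
    finally show ?thesis using Q_gt X_ge by linarith
  qed
  define A B where "A = {a \<in> {0..<Q}. radix_norm h d a \<le> r}"
    and "B = {a \<in> {0..<Q}. radix_norm h d a \<le> r'}"
  have card_ball: "card {a \<in> {0..<Q}. radix_norm h d a \<le> \<lfloor>x\<^sup>2\<rfloor>} = card (zball d h x)" if "0 \<le> x" for x
    using card_radix_ball[of h d x] h0 unfolding sqrt_le_iff_le_floor[OF that] Q_def M_def by simp
  have cards: "real (card B) \<le> E * real (card A)"
    unfolding A_def B_def r_def r'_def using card_ball[of R] card_ball[of "R + \<Delta>"] R \<Delta>0 by simp
  have "(\<lambda>k\<in>{..<d}. 0) \<in> zball d h R"
    using R h0 by (auto simp: zball_def L2_set_def)
  then have "0 < card (zball d h R)" using finite_zball by (auto simp: card_gt_0_iff)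
  then have "card A \<noteq> 0" unfolding A_def r_def card_ball[OF R(1)] by simp
  then have A: "A \<noteq> {}" by auto
  have AB: "A \<subseteq> B" using r by (auto simp: A_def B_def)
  have BQ: "B \<subseteq> {0..<Q}" by (auto simp: B_def)
  obtain a where a: "real_of_int Q < 2 ^ a" "2 ^ a \<le> 2 * real_of_int Q"
    using power_two_above[of "of_int Q"] Q_gt by auto
  \<comment> \<open>Twice \<open>2 * a + 1\<close>: the square of 3/2 exceeds 2, and
    \<open>2 * Q^2 < 2^(2 * a + 1)\<close>.\<close>
  define T where "T = 4 * a + 2"
  have T: "2 * (real_of_int Q)\<^sup>2 < (3/2) ^ T"
  proof -
    have "(real_of_int Q)\<^sup>2 < (2 ^ a)\<^sup>2" using a Q_gt by (intro power_strict_mono) auto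
    also have "\<dots> = 2 ^ (2 * a)" by (simp add: power_mult[symmetric] mult.commute)
    finally have "2 * (real_of_int Q)\<^sup>2 < 2 ^ (2 * a + 1)" by simp
    also have "\<dots> \<le> (9/4) ^ (2 * a + 1)" by (intro power_mono) auto
    also have "(9/4::real) = (3/2) ^ 2" by (simp add: power_divide)
    also have "((3/2)\<^sup>2) ^ (2 * a + 1) = (3/2::real) ^ T"
      unfolding power_mult[symmetric] T_def by (rule arg_cong[where f = "\<lambda>n. (3/2) ^ n"]) simp
    finally show ?thesis .
  qed
  \<comment> \<open>The block length is packed as a single digit, so it must be below
    \<open>X = Q^6\<close>; it is at most \<open>64 * Q^4\<close>.\<close>
  have TX: "2 ^ T < X"
  proof -
    have "(2::real) ^ T = 4 * (2 ^ a) ^ 4" by (simp add: T_def power_add power_mult[symmetric] mult.commute)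
    also have "\<dots> \<le> 4 * (2 * of_int Q) ^ 4" using a by (intro mult_left_mono power_mono) auto
    also have "\<dots> = of_int (64 * Q ^ 4)" by (simp add: power_mult_distrib)
    finally have "of_int (2 ^ T) \<le> real_of_int (64 * Q ^ 4)" by simp
    then have "2 ^ T \<le> 64 * Q ^ 4" by (simp only: of_int_le_iff)
    also have "\<dots> < (Q * Q) * Q ^ 4"
    proof (rule mult_strict_right_mono)
      have "Q * 1 \<le> Q * Q" using Q_gt by (intro mult_left_mono) auto
      then show "64 < Q * Q" using Q_gt by linarith
    qed (use Q_gt in simp)
    also have "\<dots> = X" by (simp add: X_def eval_nat_numeral)
    finally show ?thesis .
  qed
  have E1: "1 \<le> E" unfolding E_def using \<Gamma> by simp
  have "1 * 1 \<le> E * ln (real_of_int Q)" using E1 lnQ1 by (intro mult_mono) auto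
  \<comment> \<open>Rounding up to a power of two costs a factor 2, which with \<open>4\<close> and
    \<open>ln Q \<le> 8 * D\<close> gives the constant 64.\<close>
  then obtain t where t: "4 * E * ln (real_of_int Q) < 2 ^ t" "2 ^ t \<le> 2 * (4 * E * ln (real_of_int Q))"
    using power_two_above[of "4 * E * ln (real_of_int Q)"] by auto
  have t_le: "2 ^ t \<le> E * (64 * D)"
  proof -
    have "E * ln (real_of_int Q) \<le> E * (8 * D)" using lnQ E1 by (intro mult_left_mono) auto
    then show ?thesis using t(2) by simp
  qed
  obtain zs ws where zs: "length zs = T" "length ws = t" "set zs \<subseteq> {0..<Q}" "set ws \<subseteq> {0..<Q}"
    "\<And>a. a \<in> {0..<Q} \<Longrightarrow> \<exists>j<2^t. (a - shift ws j) mod Q \<in> clean Q A B zs"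
    using exists_shifts[OF Q_gt(3) AB BQ A cards T t(1)] by blast
  define gs where "gs = zs @ ws"
  have ex: "\<exists>j<2 ^ length gs. wins (2 ^ T) (\<lambda>j. cell_norm d h l gs x j \<le> r)
      (\<lambda>j. cell_norm d h l gs x j \<le> r') j" for x
  proof -
    let ?a = "grid_code h d (grid h l x)"
    have a: "?a \<in> {0..<Q}" using Q_gt by (simp add: grid_code_def Q_def M_def)
    \<comment> \<open>Norms depend only on residues, so membership in \<open>A\<close> or
      \<open>B\<close> becomes a comparison of \<open>cell_norm\<close> with \<open>r\<close> or
      \<open>r'\<close>.\<close>
    have "radix_norm h d (b mod Q) = radix_norm h d b" for b
      unfolding radix_norm_def Q_def M_def
      by (intro sum.cong refl arg_cong[where f = "\<lambda>z. z\<^sup>2"] bdigit_cong) simp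
    then have mem: "(?a - shift gs j) mod Q \<in> A \<longleftrightarrow> cell_norm d h l gs x j \<le> r"
      "(?a - shift gs j) mod Q \<in> B \<longleftrightarrow> cell_norm d h l gs x j \<le> r'" for j
      using Q_gt by (auto simp: A_def B_def cell_norm_def)
    obtain j where "j < 2 ^ length ws" "(?a - shift ws j) mod Q \<in> clean Q A B zs"
      using zs(2) zs(5)[OF a] by blast
    from exists_wins[OF this] show ?thesis
      unfolding gs_def[symmetric] mem zs(1) .
  qed
  define descr where "descr = enc X (r # r' # int (2 ^ T) # gs)"
  have gsX: "set gs \<subseteq> {0..<X}" using zs X_ge by (force simp: gs_def)
  then have all: "set (r # r' # int (2 ^ T) # gs) \<subseteq> {0..<X}"
    using r r'X TX by auto
  have descr_pos: "0 < descr" unfolding descr_def by (rule enc_pos[OF X_ge(2) all])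
  have ln_descr: "ln (real_of_int descr) \<le> 5000 * D\<^sup>2"
  proof -
    \<comment> \<open>The number of packed entries: all generators and the three values
      \<open>r\<close>, \<open>r'\<close> and \<open>2 ^ T\<close>.\<close>
    define n where "n = T + t + 3"
    have D1: "1 * D \<le> D\<^sup>2" unfolding power2_eq_square using D4 by (intro mult_right_mono) auto
    have ln2: "ln (2::real) \<le> 1" using ln_le_minus_one[of "2::real"] by simp
    have "real a \<le> 2 * ln (2 * real_of_int Q)" by (rule power_two_le_imp[OF a(2)])
    also have "ln (2 * real_of_int Q) = ln 2 + ln (real_of_int Q)" using Q_gt by (simp add: ln_mult)
    also have "2 * (ln 2 + ln (real_of_int Q)) \<le> 2 * (1 + 8 * D)"
      using ln2 lnQ by (intro mult_left_mono add_mono) auto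
    finally have a_le: "real a \<le> 2 + 16 * D" by simp
    have "real t \<le> 2 * ln (E * (64 * D))" by (rule power_two_le_imp[OF t_le])
    also have "ln (E * (64 * D)) = 8 * real d / \<Gamma> + (ln 64 + ln D)"
      using D4 by (simp add: E_def ln_mult)
    \<comment> \<open>Here \<open>8 \<le> \<Gamma>\<close> keeps \<open>ln E\<close>, and thereby
      \<open>t\<close>, of order \<open>D\<close>.\<close>
    also have "8 * real d / \<Gamma> \<le> D"
    proof -
      have "8 * real d / \<Gamma> \<le> real d" using \<Gamma> by (simp add: divide_le_eq mult.commute mult_right_mono)
      then show ?thesis using dD by linarith
    qed
    also have "ln (64::real) = 6 * ln 2" using ln_realpow[of "2::real" 6] by simp
    also have "ln D \<le> D" using ln_le_minus_one[of D] D4 by simp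
    finally have "real t \<le> 12 + 4 * D" using ln2 by simp
    then have "real n \<le> 25 + 68 * D" using a_le by (simp add: n_def T_def)
    then have n_le: "real n \<le> 75 * D" using D4 by linarith
    have "descr < 2 * X ^ n"
    proof -
      have "length (r # r' # int (2 ^ T) # gs) = n" using zs by (simp add: n_def gs_def)
      then show ?thesis using enc_less[OF _ all] X_ge unfolding descr_def by simp
    qed
    then have "real_of_int descr \<le> real_of_int (2 * X ^ n)" by linarith
    then have "ln (real_of_int descr) \<le> ln (real_of_int (2 * X ^ n))"
      using descr_pos by (intro ln_mono) auto
    also have "\<dots> = ln 2 + real n * ln (real_of_int X)"
      using X_ge by (simp add: ln_mult ln_realpow)
    also have "ln (real_of_int X) = 6 * ln (real_of_int Q)"
      using Q_gt by (simp add: X_def ln_mult)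
    finally have 1: "ln (real_of_int descr) \<le> 1 + real n * (6 * ln (real_of_int Q))" using ln2 by simp
    have "real n * (6 * ln (real_of_int Q)) \<le> (75 * D) * (6 * (8 * D))"
      using n_le lnQ lnQ1 D4 by (intro mult_mono) auto
    also have "\<dots> = 3600 * D\<^sup>2" by (simp add: power2_eq_square)
    finally show ?thesis using 1 D1 D4 by linarith
  qed
  have nat_descr: "1 \<le> nat descr" "int (nat descr) = descr" using descr_pos by linarith+
  obtain w where w: "horner_sum of_bool 2 (w @ [True]) = descr" "2 ^ length w \<le> nat descr"
    using exists_bits[OF nat_descr(1)] unfolding nat_descr(2) by blast
  have len: "real (length w) \<le> 10000 * D\<^sup>2"
  proof -
    have "2 ^ length w \<le> real (nat descr)" using w(2) by (metis of_nat_le_iff of_nat_numeral of_nat_power)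
    then have "real (length w) \<le> 2 * ln (real_of_int descr)"
      using power_two_le_imp[of "length w" "real_of_int descr"] descr_pos by simp
    then show ?thesis using ln_descr by linarith
  qed
  have cap: "real (capacity (vars_com hash_prog) descr) \<le> real (card (vars_com hash_prog)) * 10002 * D\<^sup>2"
  proof -
    define f where "f = floorlog 2 (nat descr)"
    have "2 ^ (f - 1) \<le> nat descr" unfolding f_def using nat_descr(1) floorlog_bounds[of "nat descr" 2] by simp
    then have "2 ^ (f - 1) \<le> real (nat descr)" by (metis of_nat_le_iff of_nat_numeral of_nat_power)
    then have "real (f - 1) \<le> 2 * ln (real_of_int descr)"
      using power_two_le_imp[of "f - 1" "real_of_int descr"] descr_pos by simp
    then have "real f + 1 \<le> 10000 * D\<^sup>2 + 2" using ln_descr by linarith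
    also have "\<dots> \<le> 10002 * D\<^sup>2"
    proof -
      have "1 \<le> D\<^sup>2" using D4 by (intro one_le_power) auto
      then show ?thesis by simp
    qed
    finally have "real (card (vars_com hash_prog)) * (real f + 1) \<le> real (card (vars_com hash_prog)) * (10002 * D\<^sup>2)"
      by (intro mult_left_mono) auto
    then show ?thesis by (simp add: capacity_def f_def[symmetric] algebra_simps)
  qed
  have hash: "is_hash d \<Gamma> (E * (64 * D)) l (ball_hash d h l gs (2 ^ T) r r')"
  \<comment> \<open>There is one block of \<open>2 ^ T\<close> indices for each of the
    \<open>2 ^ t\<close> shifts, so only \<open>2 ^ t\<close> enters the bound on the number of
    values.\<close>
  proof (rule is_hash_ball_hash[where N = "2 ^ t" and R = R and \<Delta> = \<Delta>])
    show "\<exists>j<2 ^ t * 2 ^ T. wins (2 ^ T) (\<lambda>j. cell_norm d h l gs x j \<le> r) (\<lambda>j. cell_norm d h l gs x j \<le> r') j" for x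
      using ex[of x] zs by (simp add: gs_def power_add mult.commute)
  qed (use d h0 l \<Gamma> R \<Delta>_def r_def r'_def t_le in simp_all)
  have "evaluates_in_space hash_prog d \<Gamma> l w x (ball_hash d h l gs (2 ^ T) r r' x)
      (real (card (vars_com hash_prog)) * 10002 * D\<^sup>2)" for x
    by (rule evaluates_hash[OF d h_eq M_def Q_def X_def r r'X _ _ gsX ex])
      (use TX w cap in \<open>simp_all add: descr_def\<close>)
  then show ?thesis
    using hash len unfolding E_def D_def by blast
qed

theorem theorem5p1:
  shows "\<exists>(P :: com) (C\<^sub>1 :: real) (C\<^sub>2 :: real) (C\<^sub>3 :: real).
    \<forall>(d :: nat) (\<Gamma> :: real) (l :: real).
      8 \<le> \<Gamma> \<and> \<Gamma> \<le> 2 * real d \<and> 0 < l \<longrightarrow>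
      (\<exists>\<phi>. is_hash d \<Gamma> (exp (8 * real d / \<Gamma>) * (C\<^sub>1 * (real d * ln (real d)))) l \<phi> \<and>
           (\<exists>w :: bool list.
              real (length w) \<le> C\<^sub>2 * ((real d)\<^sup>2 * (ln (real d))\<^sup>2) \<and>
              (\<forall>x \<in> RR d. evaluates_in_space P d \<Gamma> l w x (\<phi> x)
                            (C\<^sub>3 * ((real d)\<^sup>2 * (ln (real d))\<^sup>2)))))"
\<comment> \<open>The number of program variables is an absolute constant, since one program serves
  all \<open>d\<close>, \<open>\<Gamma>\<close> and \<open>l\<close>.\<close>
proof (rule exI[of _ hash_prog], rule exI[of _ 64], rule exI[of _ 10000],
    rule exI[of _ "real (card (vars_com hash_prog)) * 10002"], intro allI impI)
  fix d :: nat and \<Gamma> l :: real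
  assume "8 \<le> \<Gamma> \<and> \<Gamma> \<le> 2 * real d \<and> 0 < l"
  then show "\<exists>\<phi>. is_hash d \<Gamma> (exp (8 * real d / \<Gamma>) * (64 * (real d * ln (real d)))) l \<phi> \<and>
           (\<exists>w :: bool list.
              real (length w) \<le> 10000 * ((real d)\<^sup>2 * (ln (real d))\<^sup>2) \<and>
              (\<forall>x \<in> RR d. evaluates_in_space hash_prog d \<Gamma> l w x (\<phi> x)
                 (real (card (vars_com hash_prog)) * 10002 * ((real d)\<^sup>2 * (ln (real d))\<^sup>2))))"
    using hash_construction[of \<Gamma> d l] unfolding power_mult_distrib by blast
qed

end
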